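(* Let $A,B,C$ be distinct propositional variables. Consider the six predicates (1) $(A\to{\sim}A)\to{\sim}A$; (2) $A\land B\to A\circ B$; (3) $(A\to B)\to{\sim}A\lor B$; (4) $(A\to(A\to B))\to(A\to B)$; (5) $(A\to(B\to C))\to(A\land B\to C)$; (6) $(A\to(B\to C))\to((A\to B)\to(A\to C))$. Each of them belongs to $\mathsf R$ and to $\mathsf{TR}$ but not to $\mathsf{CT}_\omega$, and none of them is $\omega$-provable from commutativity. Moreover, each of them is invalid in the frame of the 2-element group, whose complex algebra is a commutative representable relation algebra.
   Context: **Predicates.** $\Pi$ is a countably infinite set of binary relation symbols containing the equality symbol $1'$; members of $\Pi$ other than $1'$ are propositional variables. $\Pi^+$ (predicates) is the absolutely free closure of $\Pi$ under the formal operators $A+B$, $\overline A$, $A;B$, $A^\smile$. Abbreviations: $A\lor B=A+B$, $A\land B=\overline{\overline A+\overline B}$, ${\sim}A=\overline{A^\smile}$, $A\to B=\overline{A^\smile;\overline B}$, $A\circ B=B;A$, $\mathbf t=1'$; $\to$ binds weakest. $\Pi^r$ is the closure of $\Pi$ under $\lor,\land,{\sim},\to,\circ,\mathbf t$. An equation is a formal expression $A\doteq B$; $A\le B$ denotes $A+B\doteq B$. $\mathfrak P=(\Pi^+,+,\overline{\phantom a},;,{}^\smile,1')$. $\Xi^d=\{A\le A;A:A\in\Pi^+\}$ (density), $\Xi^c=\{A;B\doteq B;A:A,B\in\Pi^+\}$ (commutativity). **Algebras.** A proper relation algebra is an algebra $(U,+,\overline{\phantom a},;,{}^\smile,1')$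 for which there is an equivalence relation $E\in U$ such that $U$ is a set of binary relations included in $E$, $+$ is union, $\overline X=E\setminus X$, $X;Y=\{(x,y):\exists z\,(x,z)\in X,(z,y)\in Y\}$, $X^\smile$ is the converse of $X$, and $1'=\{(x,x):(x,x)\in E\}$. A representable relation algebra is an algebra isomorphic to a proper relation algebra. An algebra is commutative if $x;y=y;x$ for all $x,y$. **Frames and $\mathsf R$.** A frame is $\mathfrak K=(K,R,{}^*,\mathcal I)$ with $R\subseteq K^3$, ${}^*\colon K\to K$, $\mathcal I\subseteq K$. Its complex algebra $\mathfrak{Cm}(\mathfrak K)$ is $(\wp(K),\cup,\overline{\phantom a},;,{}^\smile,\mathcal I)$ with $\overline X=K\setminus X$, $X;Y=\{z:Rxyz\text{ for some }x\in X,y\in Y\}$, $X^\smile=\{z^*:z\in X\}$. $A\in\Pi^+$ is valid in $\mathfrak K$ if $\mathcal I\subseteq h(A)$ for every homomorphism $h\colon\mathfrak P\to\mathfrak{Cm}(\mathfrak K)$, and invalid otherwise. The frame of a group with underlying set $K$, inverse ${}^*$ and identity $e$ is $(K,R,{}^*,\{e\})$ with $Rxyz$ iff the product of $x$ and $y$ is $z$. A $\mathsf{CR}^*$-frame is a frame with $\mathcal I=\{0\}$ and, for all $a,b,c,d$: $R0ab\Leftrightarrow a=b$; $\exists x(Rabx\land Rxcd)\Leftrightarrow\exists y(Racy\land Rybd)$; $Raaa$; $a^{**}=a$; $Rabc\Leftrightarrow Rac^*b^*$. $\mathsf{CR}^*$ is the set of predicates valid in every $\mathsf{CR}^*$-frame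 and $\mathsf R=\mathsf{CR}^*\cap\Pi^r$. **First-order provability.** For $3\le n\le\omega$ let $\Upsilon_n=\{v_i:i<n\}$ and let $\Phi_n^+$ be the set of formulas built from $xAy$ ($x,y\in\Upsilon_n$, $A\in\Pi^+$) and equations (no free variables) by $\Rightarrow,\neg,\forall x$ with $x\in\Upsilon_n$ ($\lor,\land,\Leftrightarrow,\exists$ the usual abbreviations). $[\varphi]$ is the universal closure; $S_{xy}\varphi$ interchanges $x$ and $y$ everywhere in $\varphi$ (including in quantifiers). Axioms, for $\varphi,\psi,\xi\in\Phi_n^+$, $x,y\in\Upsilon_n$, $A,B\in\Pi^+$: $[(\varphi\Rightarrow\psi)\Rightarrow((\psi\Rightarrow\xi)\Rightarrow(\varphi\Rightarrow\xi))]$; $[(\neg\varphi\Rightarrow\varphi)\Rightarrow\varphi]$; $[\varphi\Rightarrow(\neg\varphi\Rightarrow\psi)]$; $[\forall x\forall y\varphi\Rightarrow\forall y\forall x\varphi]$; $[\forall x(\varphi\Rightarrow\psi)\Rightarrow(\forall x\varphi\Rightarrow\forall x\psi)]$; $[\forall x\varphi\Rightarrow\varphi]$; $[\varphi\Rightarrow\forall x\varphi]$ if $x$ is not free in $\varphi$; $[\exists x(x1'y)]$ if $x\ne y$; a Leibniz axiom, namely $[x1'y\Rightarrow(\varphi\Rightarrow S_{xy}\varphi)]$ if $n<\omega$, and $[x1'y\Rightarrow(\varphi\Rightarrow\psi)]$ if $n=\omega$, where in the latter case $\varphi$ is atomic, $x$ occurs in $\varphi$ and $\psi$ results from $\varphi$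 by replacing one occurrence of $x$ by $y$; $[v_0(A+B)v_1\Leftrightarrow v_0Av_1\lor v_0Bv_1]$; $[v_0\overline Av_1\Leftrightarrow\neg v_0Av_1]$; $[v_0(A;B)v_1\Leftrightarrow\exists v_2(v_0Av_2\land v_2Bv_1)]$; $[v_0A^\smile v_1\Leftrightarrow v_1Av_0]$; $A\doteq B\Leftrightarrow[v_0Av_1\Leftrightarrow v_0Bv_1]$. Provability from $\Psi$ (membership in every set containing $\Psi$ and the axioms and closed under modus ponens) is written $\vdash_4^+$ for $n=4$ and $\vdash^+$ for $n=\omega$. $\mathsf{TR}=\{A\in\Pi^+:\Xi^d\cup\Xi^c\vdash_4^+1'\le A\}$ and $\mathsf{CT}_\omega=\{A\in\Pi^+:\ \vdash^+1'\le A\}$. **Sequent calculus.** An $\omega$-sequent $\Gamma\,|\,\Delta$ is a pair of subsets of $\{xAy:x,y\in\Upsilon_\omega,A\in\Pi^+\}$. It is an axiom if $\Gamma\cap\Delta\ne\emptyset$ or $x1'x\in\Delta$ for some $x$. Rules (premises $\leadsto$ conclusion): Cut: $\Gamma|\Delta,xAy$ and $xAy,\Gamma'|\Delta'\leadsto\Gamma,\Gamma'|\Delta,\Delta'$. Equality: $xAy,\Gamma|\Delta\leadsto xAz,z1'y,\Gamma|\Delta$. Sum: $xAy,\Gamma|\Delta$ and $xBy,\Gamma'|\Delta'\leadsto x(A+B)y,\Gamma,\Gamma'|\Delta,\Delta'$; $\Gamma|\Delta,xAy,xBy\leadsto\Gamma|\Delta,x(A+B)y$. Complement: $\Gamma|\Delta,xAy\leadsto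 x\overline Ay,\Gamma|\Delta$; $xAy,\Gamma|\Delta\leadsto\Gamma|\Delta,x\overline Ay$. Relative product: $xAy,yBz,\Gamma|\Delta\leadsto x(A;B)z,\Gamma|\Delta$ provided $y\ne x,z$ and $y$ occurs in no formula of $\Gamma\cup\Delta$; $\Gamma|\Delta,xAy$ and $\Gamma'|\Delta',yBz\leadsto\Gamma,\Gamma'|\Delta,\Delta',x(A;B)z$. Converse: $xAy,\Gamma|\Delta\leadsto yA^\smile x,\Gamma|\Delta$; $\Gamma|\Delta,xAy\leadsto\Gamma|\Delta,yA^\smile x$. A predicate $A$ is $\omega$-provable from commutativity if $\;|\;v_0Av_0$ lies in every set of $\omega$-sequents that contains the axioms and all sequents $v_iXv_j,\Gamma|v_iYv_j,\Delta$ and $v_iYv_j,\Gamma|v_iXv_j,\Delta$ with $X\doteq Y$ in $\Xi^c$, and is closed under the rules. *)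

theory Defs
  imports "HOL-Algebra.Coset" "HOL-Library.Extended_Nat"
begin

datatype rpred =
    PVar nat
  | POne                 ("\<^bold>1''")
  | PAdd rpred rpred     (infixl "\<^bold>+" 65)
  | PCompl rpred         ("\<^bold>- _" [81] 80)
  | PComp rpred rpred    (infixl "\<^bold>;" 70)
  | PConv rpred          ("_\<^sup>\<smile>" [90] 90)

definition prop_vars :: "rpred set" where
  "prop_vars = range PVar"

definition basic_preds :: "rpred set" where
  "basic_preds = insert \<^bold>1' prop_vars"

abbreviation POr :: "rpred \<Rightarrow> rpred \<Rightarrow> rpred" (infixl "\<^bold>\<or>" 62) where
  "A \<^bold>\<or> B \<equiv> A \<^bold>+ B"

abbreviation PAnd :: "rpred \<Rightarrow> rpred \<Rightarrow> rpred" (infixl "\<^bold>\<and>" 63) where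
  "A \<^bold>\<and> B \<equiv> \<^bold>- (\<^bold>- A \<^bold>+ \<^bold>- B)"

abbreviation PNot :: "rpred \<Rightarrow> rpred" ("\<^bold>\<sim> _" [81] 80) where
  "\<^bold>\<sim> A \<equiv> \<^bold>- (A\<^sup>\<smile>)"

abbreviation PImp :: "rpred \<Rightarrow> rpred \<Rightarrow> rpred" (infixr "\<^bold>\<rightarrow>" 60) where
  "A \<^bold>\<rightarrow> B \<equiv> \<^bold>- (A\<^sup>\<smile> \<^bold>; \<^bold>- B)"

abbreviation PFus :: "rpred \<Rightarrow> rpred \<Rightarrow> rpred" (infixl "\<^bold>\<circ>" 70) where
  "A \<^bold>\<circ> B \<equiv> B \<^bold>; A"

abbreviation PTruth :: rpred ("\<^bold>t") where
  "\<^bold>t \<equiv> \<^bold>1'"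

inductive_set relevant_preds :: "rpred set" where
  "A \<in> basic_preds \<Longrightarrow> A \<in> relevant_preds"
| "\<lbrakk>A \<in> relevant_preds; B \<in> relevant_preds\<rbrakk> \<Longrightarrow> A \<^bold>\<or> B \<in> relevant_preds"
| "\<lbrakk>A \<in> relevant_preds; B \<in> relevant_preds\<rbrakk> \<Longrightarrow> A \<^bold>\<and> B \<in> relevant_preds"
| "A \<in> relevant_preds \<Longrightarrow> \<^bold>\<sim> A \<in> relevant_preds"
| "\<lbrakk>A \<in> relevant_preds; B \<in> relevant_preds\<rbrakk> \<Longrightarrow> A \<^bold>\<rightarrow> B \<in> relevant_preds"
| "\<lbrakk>A \<in> relevant_preds; B \<in> relevant_preds\<rbrakk> \<Longrightarrow> A \<^bold>\<circ> B \<in> relevant_preds"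
| "\<^bold>t \<in> relevant_preds"

record 'a rel_alg =
  ra_univ  :: "'a set"
  ra_plus  :: "'a \<Rightarrow> 'a \<Rightarrow> 'a"
  ra_compl :: "'a \<Rightarrow> 'a"
  ra_comp  :: "'a \<Rightarrow> 'a \<Rightarrow> 'a"
  ra_conv  :: "'a \<Rightarrow> 'a"
  ra_one   :: "'a"

definition is_algebra :: "'a rel_alg \<Rightarrow> bool" where
  "is_algebra \<AA> \<longleftrightarrow>
     (\<forall>x\<in>ra_univ \<AA>. \<forall>y\<in>ra_univ \<AA>.
        ra_plus \<AA> x y \<in> ra_univ \<AA> \<and> ra_comp \<AA> x y \<in> ra_univ \<AA>) \<and>
     (\<forall>x\<in>ra_univ \<AA>. ra_compl \<AA> x \<in> ra_univ \<AA> \<and> ra_conv \<AA> x \<in> ra_univ \<AA>) \<and>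
     ra_one \<AA> \<in> ra_univ \<AA>"

definition ra_hom :: "'a rel_alg \<Rightarrow> 'b rel_alg \<Rightarrow> ('a \<Rightarrow> 'b) set" where
  "ra_hom \<AA> \<BB> = {h.
     (\<forall>x\<in>ra_univ \<AA>. h x \<in> ra_univ \<BB>) \<and>
     (\<forall>x\<in>ra_univ \<AA>. \<forall>y\<in>ra_univ \<AA>. h (ra_plus \<AA> x y) = ra_plus \<BB> (h x) (h y)) \<and>
     (\<forall>x\<in>ra_univ \<AA>. h (ra_compl \<AA> x) = ra_compl \<BB> (h x)) \<and>
     (\<forall>x\<in>ra_univ \<AA>. \<forall>y\<in>ra_univ \<AA>. h (ra_comp \<AA> x y) = ra_comp \<BB> (h x) (h y)) \<and>
     (\<forall>x\<in>ra_univ \<AA>. h (ra_conv \<AA> x) = ra_conv \<BB> (h x)) \<and>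
     h (ra_one \<AA>) = ra_one \<BB>}"

definition ra_isomorphic :: "'a rel_alg \<Rightarrow> 'b rel_alg \<Rightarrow> bool" where
  "ra_isomorphic \<AA> \<BB> \<longleftrightarrow> (\<exists>h\<in>ra_hom \<AA> \<BB>. bij_betw h (ra_univ \<AA>) (ra_univ \<BB>))"

definition proper_relation_algebra :: "('u \<times> 'u) set rel_alg \<Rightarrow> bool" where
  "proper_relation_algebra \<AA> \<longleftrightarrow> is_algebra \<AA> \<and>
     (\<exists>E\<in>ra_univ \<AA>. equiv (Field E) E \<and>
        (\<forall>X\<in>ra_univ \<AA>. X \<subseteq> E) \<and>
        (\<forall>X\<in>ra_univ \<AA>. \<forall>Y\<in>ra_univ \<AA>. ra_plus \<AA> X Y = X \<union> Y) \<and>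
        (\<forall>X\<in>ra_univ \<AA>. ra_compl \<AA> X = E - X) \<and>
        (\<forall>X\<in>ra_univ \<AA>. \<forall>Y\<in>ra_univ \<AA>. ra_comp \<AA> X Y = X O Y) \<and>
        (\<forall>X\<in>ra_univ \<AA>. ra_conv \<AA> X = X\<inverse>) \<and>
        ra_one \<AA> = {(x, x) | x. (x, x) \<in> E})"

text \<open>HOL cannot quantify over the type of the points on which the representing relations
  live. The type \<^typ>\<open>'a + nat\<close> is large enough: by the downward Loewenheim-Skolem
  argument, an algebra with elements in \<^typ>\<open>'a\<close> that is isomorphic to a proper relation
  algebra at all is isomorphic to one whose relations live on at most
  max(card \<^typ>\<open>'a\<close>, aleph-0) points.\<close>

definition representable_relation_algebra :: "'a rel_alg \<Rightarrow> bool" where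
  "representable_relation_algebra \<AA> \<longleftrightarrow> is_algebra \<AA> \<and>
     (\<exists>\<BB> :: (('a + nat) \<times> ('a + nat)) set rel_alg.
        proper_relation_algebra \<BB> \<and> ra_isomorphic \<AA> \<BB>)"

definition commutative_algebra :: "'a rel_alg \<Rightarrow> bool" where
  "commutative_algebra \<AA> \<longleftrightarrow>
     (\<forall>x\<in>ra_univ \<AA>. \<forall>y\<in>ra_univ \<AA>. ra_comp \<AA> x y = ra_comp \<AA> y x)"

definition pred_alg :: "rpred rel_alg" where
  "pred_alg = \<lparr>ra_univ = UNIV, ra_plus = PAdd, ra_compl = PCompl,
     ra_comp = PComp, ra_conv = PConv, ra_one = \<^bold>1'\<rparr>"

record 'a frame =
  fr_pts  :: "'a set"
  fr_rel  :: "'a \<Rightarrow> 'a \<Rightarrow> 'a \<Rightarrow> bool"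
  fr_star :: "'a \<Rightarrow> 'a"
  fr_ids  :: "'a set"

definition is_frame :: "'a frame \<Rightarrow> bool" where
  "is_frame F \<longleftrightarrow>
     (\<forall>x y z. fr_rel F x y z \<longrightarrow> x \<in> fr_pts F \<and> y \<in> fr_pts F \<and> z \<in> fr_pts F) \<and>
     (\<forall>x\<in>fr_pts F. fr_star F x \<in> fr_pts F) \<and>
     fr_ids F \<subseteq> fr_pts F"

definition complex_algebra :: "'a frame \<Rightarrow> 'a set rel_alg" where
  "complex_algebra F =
    \<lparr>ra_univ = Pow (fr_pts F),
     ra_plus = (\<lambda>X Y. X \<union> Y),
     ra_compl = (\<lambda>X. fr_pts F - X),
     ra_comp = (\<lambda>X Y. {z. \<exists>x\<in>X. \<exists>y\<in>Y. fr_rel F x y z}),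
     ra_conv = (\<lambda>X. fr_star F ` X),
     ra_one = fr_ids F\<rparr>"

definition valid_in :: "'a frame \<Rightarrow> rpred \<Rightarrow> bool" where
  "valid_in F A \<longleftrightarrow> (\<forall>h\<in>ra_hom pred_alg (complex_algebra F). fr_ids F \<subseteq> h A)"

definition group_frame :: "('a, 'm) monoid_scheme \<Rightarrow> 'a frame" where
  "group_frame G =
    \<lparr>fr_pts = carrier G,
     fr_rel = (\<lambda>x y z. x \<in> carrier G \<and> y \<in> carrier G \<and> z \<in> carrier G \<and> x \<otimes>\<^bsub>G\<^esub> y = z),
     fr_star = (\<lambda>x. inv\<^bsub>G\<^esub> x),
     fr_ids = {\<one>\<^bsub>G\<^esub>}\<rparr>"

definition is_CR_frame :: "'a frame \<Rightarrow> bool" where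
  "is_CR_frame F \<longleftrightarrow> is_frame F \<and>
    (\<exists>z. fr_ids F = {z} \<and>
      (\<forall>a\<in>fr_pts F. \<forall>b\<in>fr_pts F. \<forall>c\<in>fr_pts F. \<forall>d\<in>fr_pts F.
        (fr_rel F z a b \<longleftrightarrow> a = b) \<and>
        ((\<exists>x\<in>fr_pts F. fr_rel F a b x \<and> fr_rel F x c d) \<longleftrightarrow>
         (\<exists>y\<in>fr_pts F. fr_rel F a c y \<and> fr_rel F y b d)) \<and>
        fr_rel F a a a \<and>
        fr_star F (fr_star F a) = a \<and>
        (fr_rel F a b c \<longleftrightarrow> fr_rel F a (fr_star F c) (fr_star F b))))"

text \<open>The type argument is the type of the points of the frames. Frames on all subsets of the
  type are admitted, so membership in the sets of predicates intended here amounts to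
  membership for every instance of the type variable.\<close>

definition CR_star :: "'k itself \<Rightarrow> rpred set" where
  "CR_star _ = {A. \<forall>F :: 'k frame. is_CR_frame F \<longrightarrow> valid_in F A}"

definition R_logic :: "'k itself \<Rightarrow> rpred set" where
  "R_logic T = CR_star T \<inter> relevant_preds"

text \<open>The variable \<open>v\<^sub>i\<close> is represented by its index \<open>i\<close>.\<close>

datatype fm =
    FAtom nat rpred nat
  | FEq rpred rpred   (infix "\<^bold>\<doteq>" 55)
  | FImp fm fm        (infixr "\<^bold>\<Rightarrow>" 45)
  | FNeg fm           ("\<^bold>\<not> _" [51] 50)
  | FAll nat fm

abbreviation FOr :: "fm \<Rightarrow> fm \<Rightarrow> fm" where
  "FOr \<phi> \<psi> \<equiv> \<^bold>\<not> \<phi> \<^bold>\<Rightarrow> \<psi>"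

abbreviation FAnd :: "fm \<Rightarrow> fm \<Rightarrow> fm" where
  "FAnd \<phi> \<psi> \<equiv> \<^bold>\<not> (\<phi> \<^bold>\<Rightarrow> \<^bold>\<not> \<psi>)"

abbreviation FIff :: "fm \<Rightarrow> fm \<Rightarrow> fm" where
  "FIff \<phi> \<psi> \<equiv> FAnd (\<phi> \<^bold>\<Rightarrow> \<psi>) (\<psi> \<^bold>\<Rightarrow> \<phi>)"

abbreviation FEx :: "nat \<Rightarrow> fm \<Rightarrow> fm" where
  "FEx x \<phi> \<equiv> \<^bold>\<not> FAll x (\<^bold>\<not> \<phi>)"

abbreviation FLe :: "rpred \<Rightarrow> rpred \<Rightarrow> fm" (infix "\<^bold>\<le>" 55) where
  "A \<^bold>\<le> B \<equiv> A \<^bold>+ B \<^bold>\<doteq> B"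

definition density_eqs :: "fm set" where
  "density_eqs = {A \<^bold>\<le> A \<^bold>; A | A. True}"

definition commutativity_eqs :: "fm set" where
  "commutativity_eqs = {A \<^bold>; B \<^bold>\<doteq> B \<^bold>; A | A B. True}"

text \<open>\<open>n = \<infinity>\<close> plays the role of \<open>\<omega>\<close>; only \<open>3 \<le> n\<close> is intended.\<close>

definition Vars :: "enat \<Rightarrow> nat set" where
  "Vars n = {i. enat i < n}"

inductive_set Fms :: "enat \<Rightarrow> fm set" for n where
  "\<lbrakk>x \<in> Vars n; y \<in> Vars n\<rbrakk> \<Longrightarrow> FAtom x A y \<in> Fms n"
| "(A \<^bold>\<doteq> B) \<in> Fms n"
| "\<lbrakk>\<phi> \<in> Fms n; \<psi> \<in> Fms n\<rbrakk> \<Longrightarrow> (\<phi> \<^bold>\<Rightarrow> \<psi>) \<in> Fms n"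
| "\<phi> \<in> Fms n \<Longrightarrow> (\<^bold>\<not> \<phi>) \<in> Fms n"
| "\<lbrakk>x \<in> Vars n; \<phi> \<in> Fms n\<rbrakk> \<Longrightarrow> FAll x \<phi> \<in> Fms n"

primrec free_vars :: "fm \<Rightarrow> nat set" where
  "free_vars (FAtom x A y) = {x, y}"
| "free_vars (A \<^bold>\<doteq> B) = {}"
| "free_vars (\<phi> \<^bold>\<Rightarrow> \<psi>) = free_vars \<phi> \<union> free_vars \<psi>"
| "free_vars (\<^bold>\<not> \<phi>) = free_vars \<phi>"
| "free_vars (FAll x \<phi>) = free_vars \<phi> - {x}"

text \<open>In the universal closure the free variables are quantified in the order of their
  indices, the least one outermost.\<close>

definition univ_closure :: "fm \<Rightarrow> fm" where
  "univ_closure \<phi> = foldr FAll (sorted_list_of_set (free_vars \<phi>)) \<phi>"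

primrec rename_vars :: "(nat \<Rightarrow> nat) \<Rightarrow> fm \<Rightarrow> fm" where
  "rename_vars f (FAtom x A y) = FAtom (f x) A (f y)"
| "rename_vars f (A \<^bold>\<doteq> B) = (A \<^bold>\<doteq> B)"
| "rename_vars f (\<phi> \<^bold>\<Rightarrow> \<psi>) = (rename_vars f \<phi> \<^bold>\<Rightarrow> rename_vars f \<psi>)"
| "rename_vars f (\<^bold>\<not> \<phi>) = (\<^bold>\<not> rename_vars f \<phi>)"
| "rename_vars f (FAll x \<phi>) = FAll (f x) (rename_vars f \<phi>)"

definition interchange :: "nat \<Rightarrow> nat \<Rightarrow> fm \<Rightarrow> fm" where
  "interchange x y = rename_vars (id(x := y, y := x))"

text \<open>\<open>replaces_one x y \<phi> \<psi>\<close>: \<open>\<phi>\<close> is atomic and \<open>\<psi>\<close> results from \<open>\<phi>\<close> by replacing one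
  occurrence of \<open>x\<close> by \<open>y\<close>. Equations are not mentioned since no variable occurs in them.\<close>

inductive replaces_one :: "nat \<Rightarrow> nat \<Rightarrow> fm \<Rightarrow> fm \<Rightarrow> bool" for x y where
  "replaces_one x y (FAtom x A z) (FAtom y A z)"
| "replaces_one x y (FAtom z A x) (FAtom z A y)"

inductive_set axioms_FO :: "enat \<Rightarrow> fm set" for n where
  trans: "\<lbrakk>\<phi> \<in> Fms n; \<psi> \<in> Fms n; \<xi> \<in> Fms n\<rbrakk> \<Longrightarrow>
     univ_closure ((\<phi> \<^bold>\<Rightarrow> \<psi>) \<^bold>\<Rightarrow> ((\<psi> \<^bold>\<Rightarrow> \<xi>) \<^bold>\<Rightarrow> (\<phi> \<^bold>\<Rightarrow> \<xi>))) \<in> axioms_FO n"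
| clavius: "\<phi> \<in> Fms n \<Longrightarrow>
     univ_closure ((\<^bold>\<not> \<phi> \<^bold>\<Rightarrow> \<phi>) \<^bold>\<Rightarrow> \<phi>) \<in> axioms_FO n"
| duns: "\<lbrakk>\<phi> \<in> Fms n; \<psi> \<in> Fms n\<rbrakk> \<Longrightarrow>
     univ_closure (\<phi> \<^bold>\<Rightarrow> (\<^bold>\<not> \<phi> \<^bold>\<Rightarrow> \<psi>)) \<in> axioms_FO n"
| all_comm: "\<lbrakk>\<phi> \<in> Fms n; x \<in> Vars n; y \<in> Vars n\<rbrakk> \<Longrightarrow>
     univ_closure (FAll x (FAll y \<phi>) \<^bold>\<Rightarrow> FAll y (FAll x \<phi>)) \<in> axioms_FO n"
| all_imp: "\<lbrakk>\<phi> \<in> Fms n; \<psi> \<in> Fms n; x \<in> Vars n\<rbrakk> \<Longrightarrow>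
     univ_closure (FAll x (\<phi> \<^bold>\<Rightarrow> \<psi>) \<^bold>\<Rightarrow> (FAll x \<phi> \<^bold>\<Rightarrow> FAll x \<psi>)) \<in> axioms_FO n"
| all_elim: "\<lbrakk>\<phi> \<in> Fms n; x \<in> Vars n\<rbrakk> \<Longrightarrow>
     univ_closure (FAll x \<phi> \<^bold>\<Rightarrow> \<phi>) \<in> axioms_FO n"
| all_vacuous: "\<lbrakk>\<phi> \<in> Fms n; x \<in> Vars n; x \<notin> free_vars \<phi>\<rbrakk> \<Longrightarrow>
     univ_closure (\<phi> \<^bold>\<Rightarrow> FAll x \<phi>) \<in> axioms_FO n"
| ex_eq: "\<lbrakk>x \<in> Vars n; y \<in> Vars n; x \<noteq> y\<rbrakk> \<Longrightarrow>
     univ_closure (FEx x (FAtom x \<^bold>1' y)) \<in> axioms_FO n"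
| leibniz_fin: "\<lbrakk>n < \<infinity>; \<phi> \<in> Fms n; x \<in> Vars n; y \<in> Vars n\<rbrakk> \<Longrightarrow>
     univ_closure (FAtom x \<^bold>1' y \<^bold>\<Rightarrow> (\<phi> \<^bold>\<Rightarrow> interchange x y \<phi>)) \<in> axioms_FO n"
| leibniz_omega: "\<lbrakk>n = \<infinity>; \<phi> \<in> Fms n; x \<in> Vars n; y \<in> Vars n; replaces_one x y \<phi> \<psi>\<rbrakk> \<Longrightarrow>
     univ_closure (FAtom x \<^bold>1' y \<^bold>\<Rightarrow> (\<phi> \<^bold>\<Rightarrow> \<psi>)) \<in> axioms_FO n"
| sum: "univ_closure (FIff (FAtom 0 (A \<^bold>+ B) 1) (FOr (FAtom 0 A 1) (FAtom 0 B 1)))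
     \<in> axioms_FO n"
| compl: "univ_closure (FIff (FAtom 0 (\<^bold>- A) 1) (\<^bold>\<not> FAtom 0 A 1)) \<in> axioms_FO n"
| comp: "univ_closure (FIff (FAtom 0 (A \<^bold>; B) 1) (FEx 2 (FAnd (FAtom 0 A 2) (FAtom 2 B 1))))
     \<in> axioms_FO n"
| conv: "univ_closure (FIff (FAtom 0 (A\<^sup>\<smile>) 1) (FAtom 1 A 0)) \<in> axioms_FO n"
| eqn: "FIff (A \<^bold>\<doteq> B) (univ_closure (FIff (FAtom 0 A 1) (FAtom 0 B 1))) \<in> axioms_FO n"

inductive_set provable_FO :: "enat \<Rightarrow> fm set \<Rightarrow> fm set" for n \<Psi> where
  hyp: "\<phi> \<in> \<Psi> \<Longrightarrow> \<phi> \<in> provable_FO n \<Psi>"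
| ax: "\<phi> \<in> axioms_FO n \<Longrightarrow> \<phi> \<in> provable_FO n \<Psi>"
| mp: "\<lbrakk>\<phi> \<in> provable_FO n \<Psi>; (\<phi> \<^bold>\<Rightarrow> \<psi>) \<in> provable_FO n \<Psi>\<rbrakk> \<Longrightarrow> \<psi> \<in> provable_FO n \<Psi>"

definition TR :: "rpred set" where
  "TR = {A. (\<^bold>1' \<^bold>\<le> A) \<in> provable_FO 4 (density_eqs \<union> commutativity_eqs)}"

definition CT_omega :: "rpred set" where
  "CT_omega = {A. (\<^bold>1' \<^bold>\<le> A) \<in> provable_FO \<infinity> {}}"

text \<open>The triple \<open>(x, A, y)\<close> stands for the formula \<open>xAy\<close>.\<close>

type_synonym seq_fms = "(nat \<times> rpred \<times> nat) set"

definition seq_vars :: "seq_fms \<Rightarrow> nat set" where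
  "seq_vars \<Gamma> = (\<Union>(x, A, y)\<in>\<Gamma>. {x, y})"

inductive_set provable_seq :: "fm set \<Rightarrow> (seq_fms \<times> seq_fms) set" for \<Xi> where
  ax: "\<Gamma> \<inter> \<Delta> \<noteq> {} \<Longrightarrow> (\<Gamma>, \<Delta>) \<in> provable_seq \<Xi>"
| ax_id: "(x, \<^bold>1', x) \<in> \<Delta> \<Longrightarrow> (\<Gamma>, \<Delta>) \<in> provable_seq \<Xi>"
| eqn_lr: "(X \<^bold>\<doteq> Y) \<in> \<Xi> \<Longrightarrow>
    (insert (i, X, j) \<Gamma>, insert (i, Y, j) \<Delta>) \<in> provable_seq \<Xi>"
| eqn_rl: "(X \<^bold>\<doteq> Y) \<in> \<Xi> \<Longrightarrow>
    (insert (i, Y, j) \<Gamma>, insert (i, X, j) \<Delta>) \<in> provable_seq \<Xi>"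
| cut: "\<lbrakk>(\<Gamma>, insert (x, A, y) \<Delta>) \<in> provable_seq \<Xi>;
    (insert (x, A, y) \<Gamma>', \<Delta>') \<in> provable_seq \<Xi>\<rbrakk> \<Longrightarrow>
    (\<Gamma> \<union> \<Gamma>', \<Delta> \<union> \<Delta>') \<in> provable_seq \<Xi>"
| equality: "(insert (x, A, y) \<Gamma>, \<Delta>) \<in> provable_seq \<Xi> \<Longrightarrow>
    (insert (x, A, z) (insert (z, \<^bold>1', y) \<Gamma>), \<Delta>) \<in> provable_seq \<Xi>"
| sum_l: "\<lbrakk>(insert (x, A, y) \<Gamma>, \<Delta>) \<in> provable_seq \<Xi>;
    (insert (x, B, y) \<Gamma>', \<Delta>') \<in> provable_seq \<Xi>\<rbrakk> \<Longrightarrow>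
    (insert (x, A \<^bold>+ B, y) (\<Gamma> \<union> \<Gamma>'), \<Delta> \<union> \<Delta>') \<in> provable_seq \<Xi>"
| sum_r: "(\<Gamma>, insert (x, A, y) (insert (x, B, y) \<Delta>)) \<in> provable_seq \<Xi> \<Longrightarrow>
    (\<Gamma>, insert (x, A \<^bold>+ B, y) \<Delta>) \<in> provable_seq \<Xi>"
| compl_l: "(\<Gamma>, insert (x, A, y) \<Delta>) \<in> provable_seq \<Xi> \<Longrightarrow>
    (insert (x, \<^bold>- A, y) \<Gamma>, \<Delta>) \<in> provable_seq \<Xi>"
| compl_r: "(insert (x, A, y) \<Gamma>, \<Delta>) \<in> provable_seq \<Xi> \<Longrightarrow>
    (\<Gamma>, insert (x, \<^bold>- A, y) \<Delta>) \<in> provable_seq \<Xi>"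
| comp_l: "\<lbrakk>(insert (x, A, y) (insert (y, B, z) \<Gamma>), \<Delta>) \<in> provable_seq \<Xi>;
    y \<noteq> x; y \<noteq> z; y \<notin> seq_vars (\<Gamma> \<union> \<Delta>)\<rbrakk> \<Longrightarrow>
    (insert (x, A \<^bold>; B, z) \<Gamma>, \<Delta>) \<in> provable_seq \<Xi>"
| comp_r: "\<lbrakk>(\<Gamma>, insert (x, A, y) \<Delta>) \<in> provable_seq \<Xi>;
    (\<Gamma>', insert (y, B, z) \<Delta>') \<in> provable_seq \<Xi>\<rbrakk> \<Longrightarrow>
    (\<Gamma> \<union> \<Gamma>', insert (x, A \<^bold>; B, z) (\<Delta> \<union> \<Delta>')) \<in> provable_seq \<Xi>"
| conv_l: "(insert (x, A, y) \<Gamma>, \<Delta>) \<in> provable_seq \<Xi> \<Longrightarrow>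
    (insert (y, A\<^sup>\<smile>, x) \<Gamma>, \<Delta>) \<in> provable_seq \<Xi>"
| conv_r: "(\<Gamma>, insert (x, A, y) \<Delta>) \<in> provable_seq \<Xi> \<Longrightarrow>
    (\<Gamma>, insert (y, A\<^sup>\<smile>, x) \<Delta>) \<in> provable_seq \<Xi>"

definition omega_provable_from :: "fm set \<Rightarrow> rpred \<Rightarrow> bool" where
  "omega_provable_from \<Xi> A \<longleftrightarrow> ({}, {(0, A, 0)}) \<in> provable_seq \<Xi>"

end

theory Submission
  imports Defs
begin

text \<open>
  A predicate \<open>X \<rightarrow> Y\<close> holds at the identity iff \<open>X \<le> Y\<close>, so all six predicates express
  inclusions of terms. These inclusions follow from density, associativity of the relative
  product, monotonicity, the residuation law and, for (6) only, commutativity. The same argument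
  works in a frame and inside the 4-variable calculus, where the fourth variable is what makes
  associativity derivable.

  In the group \<open>{1, g}\<close> the set \<open>{g}\<close> is not dense, since \<open>{g};{g} = {1}\<close>; the assignment
  \<open>A = {g}\<close>, \<open>C = {1}\<close> with \<open>B = {1}\<close> or \<open>B = {g}\<close> refutes every predicate of the list. The Cayley
  representation \<open>X \<mapsto> {(x, y). x\<^sup>-\<^sup>1y \<in> X}\<close> turns this into a model of the first-order calculus and
  of the sequent calculus with commutativity.
\<close>

section \<open>The first-order calculus\<close>

text \<open>Modus ponens is the only rule of the calculus and its axioms are universal closures, so
  modus ponens for open formulas, generalization and change of variables all have to be earned
  first. The Leibniz axiom of the finite calculus only permutes variables; for this reason atoms are
  treated there at two distinct variables throughout. Apart from renaming, the identity relation is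
  used in one place only inside the calculus: where 1' \<le> (X \<rightarrow> Y) is reduced to X
  \<le> Y. Monotonicity of the relative product and antitonicity of the complement then take the
  place of replacing equals by equals inside terms.\<close>

lemma Fms_simps [simp]:
  "FAtom x A y \<in> Fms n \<longleftrightarrow> x \<in> Vars n \<and> y \<in> Vars n"
  "(A \<^bold>\<doteq> B) \<in> Fms n"
  "(\<phi> \<^bold>\<Rightarrow> \<psi>) \<in> Fms n \<longleftrightarrow> \<phi> \<in> Fms n \<and> \<psi> \<in> Fms n"
  "(\<^bold>\<not> \<phi>) \<in> Fms n \<longleftrightarrow> \<phi> \<in> Fms n"
  "FAll x \<phi> \<in> Fms n \<longleftrightarrow> x \<in> Vars n \<and> \<phi> \<in> Fms n"
  by (auto intro: Fms.intros elim: Fms.cases)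

lemma finite_free_vars [simp]: "finite (free_vars \<phi>)"
  by (induction \<phi>) auto

lemma free_vars_subset_Vars: "\<phi> \<in> Fms n \<Longrightarrow> free_vars \<phi> \<subseteq> Vars n"
  by (induction \<phi>) auto

lemma free_vars_foldr_FAll [simp]: "free_vars (foldr FAll xs \<phi>) = free_vars \<phi> - set xs"
  by (induction xs) auto

lemma foldr_FAll_Fms [simp]:
  "foldr FAll xs \<phi> \<in> Fms n \<longleftrightarrow> set xs \<subseteq> Vars n \<and> \<phi> \<in> Fms n"
  by (induction xs) auto

lemma free_vars_univ_closure [simp]: "free_vars (univ_closure \<phi>) = {}"
  by (simp add: univ_closure_def)

lemma univ_closure_sentence [simp]: "free_vars \<phi> = {} \<Longrightarrow> univ_closure \<phi> = \<phi>"
  by (simp add: univ_closure_def)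

lemma univ_closure_eq_foldr:
  "sorted xs \<Longrightarrow> distinct xs \<Longrightarrow> set xs = free_vars \<phi> \<Longrightarrow> univ_closure \<phi> = foldr FAll xs \<phi>"
  unfolding univ_closure_def by (metis sorted_list_of_set.idem_if_sorted_distinct)

lemma rename_vars_comp: "rename_vars f (rename_vars g \<phi>) = rename_vars (f \<circ> g) \<phi>"
  by (induction \<phi>) auto

lemma rename_vars_foldr_FAll:
  "rename_vars f (foldr FAll xs \<phi>) = foldr FAll (map f xs) (rename_vars f \<phi>)"
  by (induction xs) auto

lemma free_vars_rename_vars: "inj f \<Longrightarrow> free_vars (rename_vars f \<phi>) = f ` free_vars \<phi>"
  by (induction \<phi>) (auto dest: injD)

lemma rename_vars_Fms:
  "\<phi> \<in> Fms n \<Longrightarrow> (\<And>x. x \<in> Vars n \<Longrightarrow> f x \<in> Vars n) \<Longrightarrow> rename_vars f \<phi> \<in> Fms n"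
  by (induction \<phi>) auto

text \<open>The valuation read off from a set of formulas, with quantified formulas counted as
  propositional atoms. For a maximal set of members of \<open>Fms n\<close> it agrees with
  membership there and extends it to all other formulas, where the clauses for implication and
  negation would otherwise fail.\<close>

primrec set_val :: "fm set \<Rightarrow> fm \<Rightarrow> bool" where
  "set_val M (FAtom x A y) \<longleftrightarrow> FAtom x A y \<in> M"
| "set_val M (A \<^bold>\<doteq> B) \<longleftrightarrow> (A \<^bold>\<doteq> B) \<in> M"
| "set_val M (\<phi> \<^bold>\<Rightarrow> \<psi>) \<longleftrightarrow> (set_val M \<phi> \<longrightarrow> set_val M \<psi>)"
| "set_val M (\<^bold>\<not> \<phi>) \<longleftrightarrow> \<not> set_val M \<phi>"
| "set_val M (FAll x \<phi>) \<longleftrightarrow> FAll x \<phi> \<in> M"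

section \<open>Modus ponens for open formulas\<close>

locale fo_calculus =
  fixes n :: enat and \<Psi> :: "fm set"
begin

abbreviation prov :: "fm set" where "prov \<equiv> provable_FO n \<Psi>"

definition derivable :: "fm \<Rightarrow> bool" ("\<turnstile> _" [40] 40) where
  "\<turnstile> \<phi> \<longleftrightarrow> \<phi> \<in> Fms n \<and> univ_closure \<phi> \<in> prov"

lemma derivable_Fms: "\<turnstile> \<phi> \<Longrightarrow> \<phi> \<in> Fms n"
  by (simp add: derivable_def)

text \<open>Peeling off the innermost quantifier leaves two uses of modus ponens under a shorter
  prefix, one on the distribution axiom and one on its result. The prefix lists exactly the free
  variables, so that the closure of this axiom literally has the prefix needed.\<close>

lemma closure_mp:
  assumes "sorted xs" "distinct xs" "set xs = free_vars (\<phi> \<^bold>\<Rightarrow> \<psi>)" "\<phi> \<in> Fms n" "\<psi> \<in> Fms n"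
    and "foldr FAll xs (\<phi> \<^bold>\<Rightarrow> \<psi>) \<in> prov" "foldr FAll xs \<phi> \<in> prov"
  shows "foldr FAll xs \<psi> \<in> prov"
  using assms
proof (induction xs arbitrary: \<phi> \<psi> rule: rev_induct)
  case Nil
  then show ?case by (auto intro: provable_FO.mp)
next
  case (snoc x xs)
  let ?a = "FAll x (\<phi> \<^bold>\<Rightarrow> \<psi>)" and ?b = "FAll x \<phi>" and ?c = "FAll x \<psi>"
  have x: "x \<in> Vars n"
    using snoc.prems free_vars_subset_Vars[of "\<phi> \<^bold>\<Rightarrow> \<psi>" n] by auto
  have s: "sorted xs" "distinct xs"
    using snoc.prems by (auto simp: sorted_append)
  have fv: "set xs = free_vars (?a \<^bold>\<Rightarrow> (?b \<^bold>\<Rightarrow> ?c))" "set xs = free_vars (?b \<^bold>\<Rightarrow> ?c)"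
    using snoc.prems by auto
  have "univ_closure (?a \<^bold>\<Rightarrow> (?b \<^bold>\<Rightarrow> ?c)) \<in> prov"
    using snoc.prems x by (intro provable_FO.ax axioms_FO.all_imp)
  then have "foldr FAll xs (?a \<^bold>\<Rightarrow> (?b \<^bold>\<Rightarrow> ?c)) \<in> prov"
    using univ_closure_eq_foldr[OF s fv(1)] by simp
  then have "foldr FAll xs (?b \<^bold>\<Rightarrow> ?c) \<in> prov"
    using snoc.prems x s fv(1) by (intro snoc.IH[of ?a "?b \<^bold>\<Rightarrow> ?c"]) auto
  then have "foldr FAll xs ?c \<in> prov"
    using snoc.prems x s fv(2) by (intro snoc.IH[of ?b ?c]) auto
  then show ?case by simp
qed

text \<open>The quantifiers after \<open>y\<close> are absorbed into \<open>?c\<close>, whose free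
  variables are then exactly \<open>us\<close>. The closures of the implications between
  \<open>?c\<close> and \<open>FAll y ?c\<close> therefore have the prefix \<open>us\<close>, and
  \<open>closure_mp\<close> applies.\<close>

lemma insert_vacuous:
  assumes "sorted (us @ y # ys)" "distinct (us @ y # ys)" "set us \<subseteq> free_vars \<phi>"
    and "y \<notin> free_vars \<phi>" "free_vars \<phi> \<subseteq> set (us @ ys)"
    and "set (us @ y # ys) \<subseteq> Vars n" "\<phi> \<in> Fms n"
  shows "foldr FAll (us @ ys) \<phi> \<in> prov \<longleftrightarrow> foldr FAll (us @ y # ys) \<phi> \<in> prov"
proof -
  let ?c = "foldr FAll ys \<phi>"
  have s: "sorted us" "distinct us" using assms by (auto simp: sorted_append)
  have fv: "set us = free_vars (?c \<^bold>\<Rightarrow> FAll y ?c)" "set us = free_vars (FAll y ?c \<^bold>\<Rightarrow> ?c)"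
    using assms by auto
  have "univ_closure (?c \<^bold>\<Rightarrow> FAll y ?c) \<in> prov" "univ_closure (FAll y ?c \<^bold>\<Rightarrow> ?c) \<in> prov"
    using assms by (intro provable_FO.ax axioms_FO.all_vacuous axioms_FO.all_elim; simp)+
  then have "foldr FAll us (?c \<^bold>\<Rightarrow> FAll y ?c) \<in> prov" "foldr FAll us (FAll y ?c \<^bold>\<Rightarrow> ?c) \<in> prov"
    by (simp_all add: univ_closure_eq_foldr[OF s fv(1)] univ_closure_eq_foldr[OF s fv(2)])
  then show ?thesis
    using closure_mp[OF s fv(1)] closure_mp[OF s fv(2)] assms by auto
qed

text \<open>Removing the outermost vacuous quantifier first keeps the prefix in front of it equal
  to the prefix of the closed axiom that justifies the step.\<close>

lemma foldr_FAll_prov_iff: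
  assumes "sorted xs" "distinct xs" "free_vars \<phi> \<subseteq> set xs" "set xs \<subseteq> Vars n" "\<phi> \<in> Fms n"
  shows "foldr FAll xs \<phi> \<in> prov \<longleftrightarrow> univ_closure \<phi> \<in> prov"
  using assms
proof (induction "length xs" arbitrary: xs rule: less_induct)
  case less
  show ?case
  proof (cases "set xs = free_vars \<phi>")
    case True
    then show ?thesis using univ_closure_eq_foldr less.prems by simp
  next
    case False
    then have "\<exists>x\<in>set xs. x \<notin> free_vars \<phi>" using less.prems by auto
    from split_list_first_prop[OF this] obtain us y ys where
      xs: "xs = us @ y # ys" "y \<notin> free_vars \<phi>" "\<forall>u\<in>set us. \<not> u \<notin> free_vars \<phi>" by auto
    then have "foldr FAll (us @ ys) \<phi> \<in> prov \<longleftrightarrow> foldr FAll xs \<phi> \<in> prov"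
      using insert_vacuous[of us y ys \<phi>] less.prems by auto
    moreover have "foldr FAll (us @ ys) \<phi> \<in> prov \<longleftrightarrow> univ_closure \<phi> \<in> prov"
      using less.prems xs by (intro less.hyps) (auto simp: sorted_append)
    ultimately show ?thesis by simp
  qed
qed

text \<open>The closures of \<phi>, of \<psi> and of the implication have different prefixes. All
  are moved to the prefix of the implication, where \<open>closure_mp\<close> works, and the
  conclusion is moved back.\<close>

lemma mp:
  assumes "\<turnstile> \<phi> \<^bold>\<Rightarrow> \<psi>" "\<turnstile> \<phi>"
  shows "\<turnstile> \<psi>"
proof -
  define xs where "xs = sorted_list_of_set (free_vars (\<phi> \<^bold>\<Rightarrow> \<psi>))"
  have f: "\<phi> \<in> Fms n" "\<psi> \<in> Fms n" using assms by (auto simp: derivable_def)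
  have s: "sorted xs" "distinct xs" "set xs = free_vars (\<phi> \<^bold>\<Rightarrow> \<psi>)"
    by (auto simp: xs_def)
  then have v: "set xs \<subseteq> Vars n" using f free_vars_subset_Vars by auto
  have sub: "free_vars (\<phi> \<^bold>\<Rightarrow> \<psi>) \<subseteq> set xs" "free_vars \<phi> \<subseteq> set xs" "free_vars \<psi> \<subseteq> set xs"
    using s by auto
  have "foldr FAll xs (\<phi> \<^bold>\<Rightarrow> \<psi>) \<in> prov" "foldr FAll xs \<phi> \<in> prov"
    using assms foldr_FAll_prov_iff[OF s(1,2) sub(1) v] foldr_FAll_prov_iff[OF s(1,2) sub(2) v]
    by (auto simp: derivable_def)
  from closure_mp[OF s f this] show ?thesis
    using foldr_FAll_prov_iff[OF s(1,2) sub(3) v f(2)] f by (simp add: derivable_def)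
qed

lemma derivable_axiom: "univ_closure \<phi> \<in> axioms_FO n \<Longrightarrow> \<phi> \<in> Fms n \<Longrightarrow> \<turnstile> \<phi>"
  by (simp add: derivable_def provable_FO.ax)

section \<open>Lukasiewicz's axioms for implication and negation\<close>

lemma luk1: "\<lbrakk>\<phi> \<in> Fms n; \<psi> \<in> Fms n; \<xi> \<in> Fms n\<rbrakk> \<Longrightarrow> \<turnstile> (\<phi> \<^bold>\<Rightarrow> \<psi>) \<^bold>\<Rightarrow> ((\<psi> \<^bold>\<Rightarrow> \<xi>) \<^bold>\<Rightarrow> (\<phi> \<^bold>\<Rightarrow> \<xi>))"
  by (intro derivable_axiom axioms_FO.trans) auto

lemma luk2: "\<phi> \<in> Fms n \<Longrightarrow> \<turnstile> (\<^bold>\<not> \<phi> \<^bold>\<Rightarrow> \<phi>) \<^bold>\<Rightarrow> \<phi>"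
  by (intro derivable_axiom axioms_FO.clavius) auto

lemma luk3: "\<lbrakk>\<phi> \<in> Fms n; \<psi> \<in> Fms n\<rbrakk> \<Longrightarrow> \<turnstile> \<phi> \<^bold>\<Rightarrow> (\<^bold>\<not> \<phi> \<^bold>\<Rightarrow> \<psi>)"
  by (intro derivable_axiom axioms_FO.duns) auto

lemma imp_trans: "\<turnstile> \<phi> \<^bold>\<Rightarrow> \<psi> \<Longrightarrow> \<turnstile> \<psi> \<^bold>\<Rightarrow> \<xi> \<Longrightarrow> \<turnstile> \<phi> \<^bold>\<Rightarrow> \<xi>"
  using mp[OF mp[OF luk1]] derivable_Fms Fms_simps(3) by metis

lemma imp_cong: "\<turnstile> \<phi> \<^bold>\<Rightarrow> \<psi> \<Longrightarrow> \<xi> \<in> Fms n \<Longrightarrow> \<turnstile> (\<psi> \<^bold>\<Rightarrow> \<xi>) \<^bold>\<Rightarrow> (\<phi> \<^bold>\<Rightarrow> \<xi>)"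
  using mp[OF luk1] derivable_Fms Fms_simps(3) by metis

lemma luk_neg_imp:
  assumes "\<phi> \<in> Fms n" "\<psi> \<in> Fms n" "\<xi> \<in> Fms n" "\<theta> \<in> Fms n"
  shows "\<turnstile> (\<phi> \<^bold>\<Rightarrow> \<^bold>\<not> \<psi>) \<^bold>\<Rightarrow> (((\<phi> \<^bold>\<Rightarrow> \<xi>) \<^bold>\<Rightarrow> \<theta>) \<^bold>\<Rightarrow> (\<psi> \<^bold>\<Rightarrow> \<theta>))"
proof -
  have "\<turnstile> (\<phi> \<^bold>\<Rightarrow> \<^bold>\<not> \<psi>) \<^bold>\<Rightarrow> ((\<^bold>\<not> \<psi> \<^bold>\<Rightarrow> \<xi>) \<^bold>\<Rightarrow> (\<phi> \<^bold>\<Rightarrow> \<xi>))"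
    using assms by (intro luk1) auto
  moreover have "\<turnstile> ((\<^bold>\<not> \<psi> \<^bold>\<Rightarrow> \<xi>) \<^bold>\<Rightarrow> (\<phi> \<^bold>\<Rightarrow> \<xi>)) \<^bold>\<Rightarrow> (\<psi> \<^bold>\<Rightarrow> (\<phi> \<^bold>\<Rightarrow> \<xi>))"
    using assms by (intro imp_cong luk3) auto
  moreover have "\<turnstile> (\<psi> \<^bold>\<Rightarrow> (\<phi> \<^bold>\<Rightarrow> \<xi>)) \<^bold>\<Rightarrow> (((\<phi> \<^bold>\<Rightarrow> \<xi>) \<^bold>\<Rightarrow> \<theta>) \<^bold>\<Rightarrow> (\<psi> \<^bold>\<Rightarrow> \<theta>))"
    using assms by (intro luk1) auto
  ultimately show ?thesis using imp_trans by blast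
qed

lemma luk_intro_clavius:
  assumes "\<phi> \<in> Fms n" "\<psi> \<in> Fms n" "\<xi> \<in> Fms n" "\<theta> \<in> Fms n"
  shows "\<turnstile> \<phi> \<^bold>\<Rightarrow> (((\<^bold>\<not> \<phi> \<^bold>\<Rightarrow> \<psi>) \<^bold>\<Rightarrow> \<xi>) \<^bold>\<Rightarrow> (\<theta> \<^bold>\<Rightarrow> \<xi>))"
  using assms imp_trans[OF luk3 luk_neg_imp] by auto

text \<open>Weakening is not yet available, so the axiom instance \<open>?X\<close> is first put
  behind the antecedent \<open>\<not> \<psi>\<close> by \<open>luk_intro_clavius\<close>; then
  \<open>?X \<Rightarrow> \<psi>\<close> gives \<open>\<not> \<psi> \<Rightarrow> \<psi>\<close>,
  hence \<psi>. The weakening law \<open>imp_K\<close> is the composition of these two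
  lemmas.\<close>

lemma luk_elim_clavius:
  assumes "\<phi> \<in> Fms n" "\<psi> \<in> Fms n"
  shows "\<turnstile> (((\<^bold>\<not> \<phi> \<^bold>\<Rightarrow> \<phi>) \<^bold>\<Rightarrow> \<phi>) \<^bold>\<Rightarrow> \<psi>) \<^bold>\<Rightarrow> \<psi>"
proof -
  let ?X = "(\<^bold>\<not> \<phi> \<^bold>\<Rightarrow> \<phi>) \<^bold>\<Rightarrow> \<phi>"
  have "\<turnstile> ?X \<^bold>\<Rightarrow> (((\<^bold>\<not> ?X \<^bold>\<Rightarrow> ?X) \<^bold>\<Rightarrow> ?X) \<^bold>\<Rightarrow> (\<^bold>\<not> \<psi> \<^bold>\<Rightarrow> ?X))"
    using assms by (intro luk_intro_clavius) auto
  then have "\<turnstile> \<^bold>\<not> \<psi> \<^bold>\<Rightarrow> ?X"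
    using assms mp luk2 by (metis Fms_simps(3,4))
  then have "\<turnstile> (?X \<^bold>\<Rightarrow> \<psi>) \<^bold>\<Rightarrow> (\<^bold>\<not> \<psi> \<^bold>\<Rightarrow> \<psi>)"
    using assms by (intro imp_cong) auto
  then show ?thesis using imp_trans luk2 assms by blast
qed

lemma imp_K: "\<phi> \<in> Fms n \<Longrightarrow> \<psi> \<in> Fms n \<Longrightarrow> \<turnstile> \<phi> \<^bold>\<Rightarrow> (\<psi> \<^bold>\<Rightarrow> \<phi>)"
  using imp_trans[OF luk_intro_clavius luk_elim_clavius] by auto

text \<open>Peirce's law \<open>((?p \<Rightarrow> \<psi>) \<Rightarrow> ?p) \<Rightarrow>
  ?p\<close> does the work: since \<open>?p\<close> is itself
  \<open>\<phi> \<Rightarrow> \<psi>\<close>, the syllogism axiom already leads from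
  \<open>\<phi> \<Rightarrow> ?p\<close> to its antecedent.\<close>

lemma imp_contract:
  assumes "\<phi> \<in> Fms n" "\<psi> \<in> Fms n"
  shows "\<turnstile> (\<phi> \<^bold>\<Rightarrow> (\<phi> \<^bold>\<Rightarrow> \<psi>)) \<^bold>\<Rightarrow> (\<phi> \<^bold>\<Rightarrow> \<psi>)"
proof -
  let ?p = "\<phi> \<^bold>\<Rightarrow> \<psi>"
  have "\<turnstile> \<^bold>\<not> ?p \<^bold>\<Rightarrow> (\<^bold>\<not> \<psi> \<^bold>\<Rightarrow> \<^bold>\<not> ?p)"
    using assms by (intro imp_K) auto
  moreover have "\<turnstile> (\<^bold>\<not> \<psi> \<^bold>\<Rightarrow> \<^bold>\<not> ?p) \<^bold>\<Rightarrow> (((\<^bold>\<not> \<psi> \<^bold>\<Rightarrow> \<psi>) \<^bold>\<Rightarrow> \<psi>) \<^bold>\<Rightarrow> (?p \<^bold>\<Rightarrow> \<psi>))"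
    using assms by (intro luk_neg_imp) auto
  moreover have "\<turnstile> (((\<^bold>\<not> \<psi> \<^bold>\<Rightarrow> \<psi>) \<^bold>\<Rightarrow> \<psi>) \<^bold>\<Rightarrow> (?p \<^bold>\<Rightarrow> \<psi>)) \<^bold>\<Rightarrow> (?p \<^bold>\<Rightarrow> \<psi>)"
    using assms by (intro luk_elim_clavius) auto
  ultimately have "\<turnstile> \<^bold>\<not> ?p \<^bold>\<Rightarrow> (?p \<^bold>\<Rightarrow> \<psi>)" using imp_trans by blast
  then have "\<turnstile> ((?p \<^bold>\<Rightarrow> \<psi>) \<^bold>\<Rightarrow> ?p) \<^bold>\<Rightarrow> (\<^bold>\<not> ?p \<^bold>\<Rightarrow> ?p)"
    using assms by (intro imp_cong) auto
  then have "\<turnstile> ((?p \<^bold>\<Rightarrow> \<psi>) \<^bold>\<Rightarrow> ?p) \<^bold>\<Rightarrow> ?p"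
    using assms imp_trans luk2 by (metis Fms_simps(3))
  moreover have "\<turnstile> (\<phi> \<^bold>\<Rightarrow> ?p) \<^bold>\<Rightarrow> ((?p \<^bold>\<Rightarrow> \<psi>) \<^bold>\<Rightarrow> ?p)"
    using assms by (intro luk1) auto
  ultimately show ?thesis using imp_trans by blast
qed

lemma imp_swap:
  assumes "\<phi> \<in> Fms n" "\<psi> \<in> Fms n" "\<xi> \<in> Fms n"
  shows "\<turnstile> (\<phi> \<^bold>\<Rightarrow> (\<psi> \<^bold>\<Rightarrow> \<xi>)) \<^bold>\<Rightarrow> (\<psi> \<^bold>\<Rightarrow> (\<phi> \<^bold>\<Rightarrow> \<xi>))"
proof -
  let ?p = "\<psi> \<^bold>\<Rightarrow> \<xi>"
  have "\<turnstile> \<psi> \<^bold>\<Rightarrow> (?p \<^bold>\<Rightarrow> \<psi>)" using assms by (intro imp_K) auto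
  moreover have "\<turnstile> (?p \<^bold>\<Rightarrow> \<psi>) \<^bold>\<Rightarrow> (?p \<^bold>\<Rightarrow> (?p \<^bold>\<Rightarrow> \<xi>))" using assms by (intro luk1) auto
  moreover have "\<turnstile> (?p \<^bold>\<Rightarrow> (?p \<^bold>\<Rightarrow> \<xi>)) \<^bold>\<Rightarrow> (?p \<^bold>\<Rightarrow> \<xi>)" using assms by (intro imp_contract) auto
  ultimately have "\<turnstile> \<psi> \<^bold>\<Rightarrow> (?p \<^bold>\<Rightarrow> \<xi>)" using imp_trans by blast
  then have "\<turnstile> ((?p \<^bold>\<Rightarrow> \<xi>) \<^bold>\<Rightarrow> (\<phi> \<^bold>\<Rightarrow> \<xi>)) \<^bold>\<Rightarrow> (\<psi> \<^bold>\<Rightarrow> (\<phi> \<^bold>\<Rightarrow> \<xi>))"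
    using assms by (intro imp_cong) auto
  moreover have "\<turnstile> (\<phi> \<^bold>\<Rightarrow> ?p) \<^bold>\<Rightarrow> ((?p \<^bold>\<Rightarrow> \<xi>) \<^bold>\<Rightarrow> (\<phi> \<^bold>\<Rightarrow> \<xi>))"
    using assms by (intro luk1) auto
  ultimately show ?thesis using imp_trans by blast
qed

text \<open>A two-valued valuation, given as its set of true formulas. The clauses for the
  connectives range over all formulas and not only over \<open>Fms n\<close>, so that they serve as
  rewrite rules without a side condition on well-formedness.\<close>

definition boolean_model :: "fm set \<Rightarrow> bool" where
  "boolean_model w \<longleftrightarrow> (\<forall>\<phi> \<psi>. (\<phi> \<^bold>\<Rightarrow> \<psi>) \<in> w \<longleftrightarrow> (\<phi> \<in> w \<longrightarrow> \<psi> \<in> w)) \<and>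
     (\<forall>\<phi>. (\<^bold>\<not> \<phi>) \<in> w \<longleftrightarrow> \<phi> \<notin> w) \<and> (\<forall>\<phi>. \<turnstile> \<phi> \<longrightarrow> \<phi> \<in> w)"

lemma boolean_model_simps [simp]:
  "boolean_model w \<Longrightarrow> (\<phi> \<^bold>\<Rightarrow> \<psi>) \<in> w \<longleftrightarrow> (\<phi> \<in> w \<longrightarrow> \<psi> \<in> w)"
  "boolean_model w \<Longrightarrow> (\<^bold>\<not> \<phi>) \<in> w \<longleftrightarrow> \<phi> \<notin> w"
  unfolding boolean_model_def by blast+

lemma boolean_modelD: "boolean_model w \<Longrightarrow> \<turnstile> \<phi> \<Longrightarrow> \<phi> \<in> w"
  unfolding boolean_model_def by blast

text \<open>Lindenbaum's lemma. It reduces derivability to truth in all boolean models, so that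
  propositional steps inside the calculus can be left to the automation.\<close>

lemma ex_boolean_model:
  assumes "\<phi> \<in> Fms n" "\<not> (\<turnstile> \<phi>)"
  shows "\<exists>w. boolean_model w \<and> \<phi> \<notin> w"
proof -
  define mpc where "mpc M \<longleftrightarrow> (\<forall>a b. a \<in> M \<longrightarrow> (a \<^bold>\<Rightarrow> b) \<in> M \<longrightarrow> b \<in> M)" for M
  define \<A> where "\<A> = {M. {\<psi>. \<turnstile> \<psi>} \<subseteq> M \<and> M \<subseteq> Fms n \<and> mpc M \<and> \<phi> \<notin> M}"
  have mpcD: "b \<in> M" if "mpc M" "(a \<^bold>\<Rightarrow> b) \<in> M" "a \<in> M" for M a b
    using that unfolding mpc_def by blast
  have "\<exists>M\<in>\<A>. \<forall>X\<in>\<A>. M \<subseteq> X \<longrightarrow> X = M"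
  proof (rule subset_Zorn_nonempty)
    have "mpc {\<psi>. \<turnstile> \<psi>}" unfolding mpc_def mem_Collect_eq by (intro allI impI) (rule mp)
    then have "{\<psi>. \<turnstile> \<psi>} \<in> \<A>"
      using assms(2) by (auto simp: \<A>_def dest: derivable_Fms)
    then show "\<A> \<noteq> {}" by blast
  next
    fix \<C> assume c: "\<C> \<noteq> {}" "subset.chain \<A> \<C>"
    then have sub: "\<C> \<subseteq> \<A>" by (simp add: subset_chain_def)
    have elt: "{\<psi>. \<turnstile> \<psi>} \<subseteq> L" "L \<subseteq> Fms n" "mpc L" "\<phi> \<notin> L" if "L \<in> \<C>" for L
      using subsetD[OF sub that] by (simp_all add: \<A>_def)
    have "b \<in> \<Union>\<C>" if ab: "a \<in> \<Union>\<C>" "(a \<^bold>\<Rightarrow> b) \<in> \<Union>\<C>" for a b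
    proof -
      obtain M N where MN: "M \<in> \<C>" "a \<in> M" "N \<in> \<C>" "(a \<^bold>\<Rightarrow> b) \<in> N" using ab by blast
      have "M \<subseteq> N \<or> N \<subseteq> M" using c(2) MN(1,3) by (simp add: subset_chain_def)
      then obtain L where L: "L \<in> \<C>" "a \<in> L" "(a \<^bold>\<Rightarrow> b) \<in> L" using MN by blast
      then show ?thesis using mpcD[OF elt(3)] by blast
    qed
    then have "mpc (\<Union>\<C>)" unfolding mpc_def by (intro allI impI)
    moreover have "{\<psi>. \<turnstile> \<psi>} \<subseteq> \<Union>\<C>" "\<Union>\<C> \<subseteq> Fms n" "\<phi> \<notin> \<Union>\<C>"
      using elt c(1) by blast+
    ultimately show "\<Union>\<C> \<in> \<A>" by (simp add: \<A>_def)
  qed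
  then obtain M where M: "M \<in> \<A>" and max: "\<And>X. X \<in> \<A> \<Longrightarrow> M \<subseteq> X \<Longrightarrow> X = M" by blast
  have thmM: "\<psi> \<in> M" if "\<turnstile> \<psi>" for \<psi> using M that by (simp add: \<A>_def subset_iff)
  have mpM: "b \<in> M" if "(a \<^bold>\<Rightarrow> b) \<in> M" "a \<in> M" for a b
    using M that mpcD[of M a b] by (simp add: \<A>_def)
  have FM: "a \<in> Fms n" if "a \<in> M" for a using M that by (simp add: \<A>_def subset_iff)
  have noM: "\<phi> \<notin> M" using M by (simp add: \<A>_def)
  have trM: "(a \<^bold>\<Rightarrow> c) \<in> M" if "(a \<^bold>\<Rightarrow> b) \<in> M" "(b \<^bold>\<Rightarrow> c) \<in> M" for a b c
    using mpM[OF mpM[OF thmM[OF luk1] that(1)] that(2)] FM[OF that(1)] FM[OF that(2)] by simp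
  have imp_fail: "(a \<^bold>\<Rightarrow> \<phi>) \<in> M" if a: "a \<notin> M" "a \<in> Fms n" for a
  proof -
    \<comment> \<open>\<open>N\<close> collects what \<open>M\<close> yields under the additional
      hypothesis \<open>a\<close>. Its closure under modus ponens is the deduction theorem in
      disguise and rests on \<open>imp_swap\<close> and \<open>imp_contract\<close>; maximality of
      \<open>M\<close> then forces \<phi> into \<open>N\<close>.\<close>
    define N where "N = {b. (a \<^bold>\<Rightarrow> b) \<in> M}"
    have KM: "b \<in> N" if "b \<in> M" for b
      using mpM[OF thmM[OF imp_K[of b a]] that] FM[OF that] a by (simp add: N_def)
    have "(a \<^bold>\<Rightarrow> a) \<in> M"
      using mpM[OF thmM[OF imp_contract[of a a]] thmM[OF imp_K[of a a]]] a by simp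
    then have aN: "a \<in> N" by (simp add: N_def)
    have mpN: "c \<in> N" if bc: "b \<in> N" "(b \<^bold>\<Rightarrow> c) \<in> N" for b c
    proof -
      have "(a \<^bold>\<Rightarrow> b) \<in> M" "(a \<^bold>\<Rightarrow> (b \<^bold>\<Rightarrow> c)) \<in> M" using bc by (auto simp: N_def)
      then have f: "b \<in> Fms n" "c \<in> Fms n" and ab: "(a \<^bold>\<Rightarrow> b) \<in> M"
        and abc: "(a \<^bold>\<Rightarrow> (b \<^bold>\<Rightarrow> c)) \<in> M"
        using FM[of "a \<^bold>\<Rightarrow> (b \<^bold>\<Rightarrow> c)"] by simp_all
      have "(b \<^bold>\<Rightarrow> (a \<^bold>\<Rightarrow> c)) \<in> M"
        using mpM[OF thmM[OF imp_swap] abc] a f by simp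
      from mpM[OF thmM[OF imp_contract] trM[OF ab this]] show ?thesis
        using a f by (simp add: N_def)
    qed
    have FN: "b \<in> Fms n" if "b \<in> N" for b using FM[of "a \<^bold>\<Rightarrow> b"] that by (simp add: N_def)
    have "N \<in> \<A>" if "\<phi> \<notin> N"
    proof -
      have "{\<psi>. \<turnstile> \<psi>} \<subseteq> N" using KM[OF thmM] by blast
      moreover have "N \<subseteq> Fms n" using FN by blast
      moreover have "mpc N" unfolding mpc_def by (intro allI impI) (erule mpN)
      ultimately show ?thesis using that by (simp add: \<A>_def)
    qed
    moreover have "N \<noteq> M" "M \<subseteq> N" using a aN KM by auto
    ultimately have "\<phi> \<in> N" using max[of N] by blast
    then show ?thesis by (simp add: N_def)
  qed
  \<comment> \<open>Otherwise \<open>\<not> \<phi> \<Rightarrow> \<phi>\<close> would lie in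
    \<open>M\<close>, and Clavius's law would put \<phi> there.\<close>
  have "(\<^bold>\<not> \<phi>) \<in> M"
    using imp_fail[of "\<^bold>\<not> \<phi>"] mpM[OF thmM[OF luk2[of \<phi>]]] assms noM by auto
  have imp_false: "(a \<^bold>\<Rightarrow> b) \<in> M" if a: "a \<notin> M" "a \<in> Fms n" "b \<in> Fms n" for a b
  proof -
    have "(a \<^bold>\<Rightarrow> (\<^bold>\<not> \<phi> \<^bold>\<Rightarrow> b)) \<in> M"
      by (rule trM[OF imp_fail thmM[OF luk3]]) (use a assms in auto)
    then show ?thesis
      using mpM[OF mpM[OF thmM[OF imp_swap[of a "\<^bold>\<not> \<phi>" b]]]] a assms \<open>(\<^bold>\<not> \<phi>) \<in> M\<close> by simp
  qed
  have neg: "(\<^bold>\<not> a) \<in> M \<longleftrightarrow> a \<notin> M" if a: "a \<in> Fms n" for a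
  proof
    assume "(\<^bold>\<not> a) \<in> M"
    then show "a \<notin> M"
      using mpM[OF mpM[OF thmM[OF luk3[of a \<phi>]]]] noM assms(1) a by auto
  next
    assume "a \<notin> M"
    then show "(\<^bold>\<not> a) \<in> M"
      using imp_false[of "\<^bold>\<not> a" a] mpM[OF thmM[OF luk2[of a]]] a by auto
  qed
  have imp: "(a \<^bold>\<Rightarrow> b) \<in> M \<longleftrightarrow> (a \<in> M \<longrightarrow> b \<in> M)" if ab: "a \<in> Fms n" "b \<in> Fms n" for a b
    using imp_false[of a b] mpM[of a b] mpM[OF thmM[OF imp_K[of b a]]] ab by blast
  have val: "set_val M a \<longleftrightarrow> a \<in> M" if "a \<in> Fms n" for a
    using that by (induction a) (auto simp: neg imp)
  have "set_val M \<psi>" if "\<turnstile> \<psi>" for \<psi>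
    using val[OF derivable_Fms[OF that]] thmM[OF that] by simp
  then have "boolean_model (Collect (set_val M))"
    by (simp add: boolean_model_def)
  moreover have "\<phi> \<notin> Collect (set_val M)" using val[OF assms(1)] noM by simp
  ultimately show ?thesis by (intro exI conjI)
qed

lemma derivable_iff: "\<turnstile> \<phi> \<longleftrightarrow> \<phi> \<in> Fms n \<and> (\<forall>w. boolean_model w \<longrightarrow> \<phi> \<in> w)"
  using ex_boolean_model[of \<phi>] boolean_modelD[of _ \<phi>] derivable_Fms[of \<phi>] by metis

section \<open>Quantifier rules\<close>

lemma all_elim:
  assumes "\<turnstile> FAll x \<phi>"
  shows "\<turnstile> \<phi>"
proof -
  have "\<turnstile> FAll x \<phi> \<^bold>\<Rightarrow> \<phi>"
    using derivable_Fms[OF assms] by (intro derivable_axiom axioms_FO.all_elim) auto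
  then show ?thesis using assms mp by blast
qed

lemma foldr_FAll_elim: "\<turnstile> foldr FAll xs \<phi> \<Longrightarrow> \<turnstile> \<phi>"
  by (induction xs) (auto dest: all_elim)

text \<open>A free \<open>x\<close> stands somewhere inside the closure prefix. Cutting the prefix
  in front of it exhibits a derivable formula that begins with \<open>FAll x\<close>; commuting this
  quantifier past the remaining ones, each of which is then stripped, moves it next to
  \<phi>.\<close>

lemma gen:
  assumes "\<turnstile> \<phi>" "x \<in> Vars n"
  shows "\<turnstile> FAll x \<phi>"
proof (cases "x \<in> free_vars \<phi>")
  case False
  have "\<turnstile> \<phi> \<^bold>\<Rightarrow> FAll x \<phi>"
    using derivable_Fms[OF assms(1)] assms(2) False
    by (intro derivable_axiom axioms_FO.all_vacuous) auto
  then show ?thesis using assms mp by blast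
next
  case True
  have f: "\<phi> \<in> Fms n" using derivable_Fms[OF assms(1)] .
  have "x \<in> set (sorted_list_of_set (free_vars \<phi>))" using True by simp
  then obtain us ys where l: "sorted_list_of_set (free_vars \<phi>) = us @ x # ys"
    using split_list by metis
  then have so: "sorted (us @ x # ys)" "distinct (us @ x # ys)" "set (us @ x # ys) = free_vars \<phi>"
    by (metis sorted_sorted_list_of_set, metis distinct_sorted_list_of_set,
        metis finite_free_vars set_sorted_list_of_set)
  have "univ_closure (foldr FAll (x # ys) \<phi>) = foldr FAll us (foldr FAll (x # ys) \<phi>)"
    using so by (intro univ_closure_eq_foldr) (auto simp: sorted_append)
  then have *: "\<turnstile> foldr FAll (x # ys) \<phi>"
    using assms so free_vars_subset_Vars[OF f] f l
    by (auto simp: derivable_def univ_closure_def)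
  have "\<turnstile> FAll x (foldr FAll zs \<phi>) \<Longrightarrow> \<turnstile> FAll x \<phi>" for zs
  proof (induction zs)
    case (Cons z zs)
    have "\<turnstile> FAll x (FAll z (foldr FAll zs \<phi>)) \<^bold>\<Rightarrow> FAll z (FAll x (foldr FAll zs \<phi>))"
      using derivable_Fms[OF Cons.prems] by (intro derivable_axiom axioms_FO.all_comm) auto
    then have "\<turnstile> FAll z (FAll x (foldr FAll zs \<phi>))" using Cons.prems mp by auto
    then show ?case using Cons.IH all_elim by blast
  qed simp
  then show ?thesis using * by simp
qed

lemma derivable_univ_closure: "\<turnstile> \<phi> \<longleftrightarrow> \<turnstile> univ_closure \<phi>"
proof
  assume "\<turnstile> \<phi>"
  then show "\<turnstile> univ_closure \<phi>"
    using derivable_Fms[of \<phi>] free_vars_subset_Vars[of \<phi> n]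
    by (simp add: derivable_def) (simp add: univ_closure_def)
next
  assume "\<turnstile> univ_closure \<phi>"
  then show "\<turnstile> \<phi>"
    unfolding univ_closure_def by (rule foldr_FAll_elim)
qed

lemma ex_intro:
  assumes "\<phi> \<in> Fms n" "x \<in> Vars n"
  shows "\<turnstile> \<phi> \<^bold>\<Rightarrow> FEx x \<phi>"
proof -
  have "\<turnstile> FAll x (\<^bold>\<not> \<phi>) \<^bold>\<Rightarrow> \<^bold>\<not> \<phi>"
    using assms by (intro derivable_axiom axioms_FO.all_elim) auto
  then show ?thesis unfolding derivable_iff by auto
qed

lemma ex_elim:
  assumes "\<turnstile> \<phi> \<^bold>\<Rightarrow> \<psi>" "x \<in> Vars n" "x \<notin> free_vars \<psi>"
  shows "\<turnstile> FEx x \<phi> \<^bold>\<Rightarrow> \<psi>"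
proof -
  have f: "\<phi> \<in> Fms n" "\<psi> \<in> Fms n" using derivable_Fms[OF assms(1)] by auto
  have "\<turnstile> \<^bold>\<not> \<psi> \<^bold>\<Rightarrow> \<^bold>\<not> \<phi>" using assms(1) unfolding derivable_iff by auto
  then have "\<turnstile> FAll x (\<^bold>\<not> \<psi> \<^bold>\<Rightarrow> \<^bold>\<not> \<phi>)" using assms(2) by (rule gen)
  moreover have "\<turnstile> FAll x (\<^bold>\<not> \<psi> \<^bold>\<Rightarrow> \<^bold>\<not> \<phi>) \<^bold>\<Rightarrow> (FAll x (\<^bold>\<not> \<psi>) \<^bold>\<Rightarrow> FAll x (\<^bold>\<not> \<phi>))"
    using f assms by (intro derivable_axiom axioms_FO.all_imp) auto
  moreover have "\<turnstile> \<^bold>\<not> \<psi> \<^bold>\<Rightarrow> FAll x (\<^bold>\<not> \<psi>)"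
    using f assms by (intro derivable_axiom axioms_FO.all_vacuous) auto
  ultimately show ?thesis unfolding derivable_iff by auto
qed

end

section \<open>Renaming and the rules for the relational operators\<close>

locale finite_fo_calculus = fo_calculus +
  assumes four_le: "4 \<le> n" and finite_n: "n < \<infinity>"
begin

lemma Vars_le_3 [simp]: "i \<le> 3 \<Longrightarrow> i \<in> Vars n"
proof -
  assume "i \<le> 3"
  then have "enat i < enat 4" by simp
  then have "enat i < 4" by (simp add: numeral_eq_enat)
  then show ?thesis using four_le by (simp add: Vars_def)
qed

text \<open>The finite calculus has no substitution axiom. Applied to a sentence, the Leibniz axiom has
  a conclusion without free \<open>x\<close>, so its premise \<open>x 1' y\<close> can be discharged by \<open>\<exists>x (x 1' y)\<close>.\<close>

lemma derivable_interchange: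
  assumes "\<turnstile> \<phi>" "x \<in> Vars n" "y \<in> Vars n"
  shows "\<turnstile> interchange x y \<phi>"
proof (cases "x = y")
  case True
  have "rename_vars id \<phi> = \<phi>" by (induction \<phi>) auto
  moreover have "id(y := y) = id" by auto
  ultimately show ?thesis using True assms by (simp add: interchange_def)
next
  case False
  let ?f = "id(x := y, y := x)" and ?c = "univ_closure \<phi>"
  have inj: "inj ?f" by (auto simp: inj_def)
  have c: "\<turnstile> ?c" using assms derivable_univ_closure by blast
  have f: "?c \<in> Fms n" "interchange x y ?c \<in> Fms n"
    using derivable_Fms[OF c] assms by (auto simp: interchange_def intro!: rename_vars_Fms)
  have "\<turnstile> FAtom x \<^bold>1' y \<^bold>\<Rightarrow> (?c \<^bold>\<Rightarrow> interchange x y ?c)"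
    using f assms finite_n by (intro derivable_axiom axioms_FO.leibniz_fin) auto
  then have "\<turnstile> FAtom x \<^bold>1' y \<^bold>\<Rightarrow> interchange x y ?c"
    using c unfolding derivable_iff by auto
  moreover have "free_vars (interchange x y ?c) = {}"
    unfolding interchange_def free_vars_rename_vars[OF inj] by simp
  ultimately have "\<turnstile> FEx x (FAtom x \<^bold>1' y) \<^bold>\<Rightarrow> interchange x y ?c"
    using assms by (intro ex_elim) auto
  moreover have "\<turnstile> FEx x (FAtom x \<^bold>1' y)"
    using assms False by (intro derivable_axiom axioms_FO.ex_eq) auto
  ultimately have "\<turnstile> interchange x y ?c" using mp by blast
  then show ?thesis
    unfolding interchange_def univ_closure_def rename_vars_foldr_FAll by (rule foldr_FAll_elim)
qed

text \<open>The axioms for the operators speak of the variables 0, 1, 2 only. Three transpositions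
  carry these to \<open>i\<close>, \<open>j\<close>, \<open>k\<close> in turn: \<open>j'\<close> is
  where the first one leaves 1, and \<open>k'\<close> is where the first two leave 2. As the targets
  are distinct, no later transposition disturbs a position already reached.\<close>

lemma ex_renaming:
  assumes "i \<in> Vars n" "j \<in> Vars n" "k \<in> Vars n" "i \<noteq> j" "i \<noteq> k" "j \<noteq> k" "\<turnstile> \<phi>"
  obtains f where "f 0 = i" "f 1 = j" "f 2 = k" "\<turnstile> rename_vars f \<phi>"
proof -
  define s where "s x y = (id(x := y, y := x) :: nat \<Rightarrow> nat)" for x y
  define j' where "j' = s 0 i 1"
  define k' where "k' = s j' j (s 0 i 2)"
  define f where "f = s k' k \<circ> (s j' j \<circ> s 0 i)"
  have v: "(0::nat) \<in> Vars n" "(1::nat) \<in> Vars n" "(2::nat) \<in> Vars n" by auto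
  have sV: "s x y z \<in> Vars n" if "x \<in> Vars n" "y \<in> Vars n" "z \<in> Vars n" for x y z
    using that by (simp add: s_def)
  have j'V: "j' \<in> Vars n" and k'V: "k' \<in> Vars n"
    using sV v assms by (simp_all add: j'_def k'_def)
  have s: "\<turnstile> rename_vars (s x y) \<phi>" if "x \<in> Vars n" "y \<in> Vars n" "\<turnstile> \<phi>" for x y \<phi>
    using derivable_interchange[OF that(3,1,2)] by (simp add: interchange_def s_def)
  have r: "\<turnstile> rename_vars f \<phi>"
    using s[OF k'V assms(3) s[OF j'V assms(2) s[OF v(1) assms(1,7)]]]
    by (simp add: f_def rename_vars_comp)
  have s_eq: "s x y x = y" and s_other: "z \<noteq> x \<Longrightarrow> z \<noteq> y \<Longrightarrow> s x y z = z" for x y z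
    by (simp_all add: s_def)
  have inj_s: "inj (s x y)" for x y by (auto simp: inj_def s_def)
  have "j' \<noteq> i"
    using inj_s[of 0 i] s_eq[of 0 i] unfolding j'_def inj_def by (metis zero_neq_one)
  then have i: "s j' j (s 0 i 0) = i" using assms(4) s_eq s_other by metis
  have j: "s j' j (s 0 i 1) = j" by (simp only: j'_def[symmetric] s_eq)
  have "k' \<noteq> s j' j (s 0 i 0)" "k' \<noteq> s j' j (s 0 i 1)"
    unfolding k'_def inj_eq[OF inj_s] by simp_all
  then have "k' \<noteq> i" "k' \<noteq> j" unfolding i j .
  then have "f 0 = i" "f 1 = j" "f 2 = k"
    using assms(5,6) i j s_eq s_other unfolding f_def k'_def comp_apply by metis+
  then show ?thesis using r by (rule that)
qed

lemma ex_renaming2: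
  assumes "i \<in> Vars n" "j \<in> Vars n" "i \<noteq> j" "\<turnstile> \<phi>"
  obtains f where "f 0 = i" "f 1 = j" "\<turnstile> rename_vars f \<phi>"
proof -
  have "\<exists>k\<le>3. i \<noteq> k \<and> j \<noteq> k" by presburger
  then obtain k where k: "k \<le> 3" "i \<noteq> k" "j \<noteq> k" by blast
  show ?thesis
    by (rule ex_renaming[OF assms(1,2) Vars_le_3[OF k(1)] assms(3) k(2,3) assms(4)]) (rule that)
qed

lemma sum_iff:
  assumes "i \<in> Vars n" "j \<in> Vars n" "i \<noteq> j"
  shows "\<turnstile> FIff (FAtom i (A \<^bold>+ B) j) (FOr (FAtom i A j) (FAtom i B j))"
proof -
  have ax: "\<turnstile> FIff (FAtom 0 (A \<^bold>+ B) 1) (FOr (FAtom 0 A 1) (FAtom 0 B 1))" (is "\<turnstile> ?\<phi>")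
    by (intro derivable_axiom axioms_FO.sum) auto
  obtain f where f: "f 0 = i" "f 1 = j" "\<turnstile> rename_vars f ?\<phi>"
    by (rule ex_renaming2[OF assms ax])
  from f(3) show ?thesis by (simp add: f(1,2) del: One_nat_def)
qed

lemma compl_iff:
  assumes "i \<in> Vars n" "j \<in> Vars n" "i \<noteq> j"
  shows "\<turnstile> FIff (FAtom i (\<^bold>- A) j) (\<^bold>\<not> FAtom i A j)"
proof -
  have ax: "\<turnstile> FIff (FAtom 0 (\<^bold>- A) 1) (\<^bold>\<not> FAtom 0 A 1)" (is "\<turnstile> ?\<phi>")
    by (intro derivable_axiom axioms_FO.compl) auto
  obtain f where f: "f 0 = i" "f 1 = j" "\<turnstile> rename_vars f ?\<phi>"
    by (rule ex_renaming2[OF assms ax])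
  from f(3) show ?thesis by (simp add: f(1,2) del: One_nat_def)
qed

lemma conv_iff:
  assumes "i \<in> Vars n" "j \<in> Vars n" "i \<noteq> j"
  shows "\<turnstile> FIff (FAtom i (A\<^sup>\<smile>) j) (FAtom j A i)"
proof -
  have ax: "\<turnstile> FIff (FAtom 0 (A\<^sup>\<smile>) 1) (FAtom 1 A 0)" (is "\<turnstile> ?\<phi>")
    by (intro derivable_axiom axioms_FO.conv) auto
  obtain f where f: "f 0 = i" "f 1 = j" "\<turnstile> rename_vars f ?\<phi>"
    by (rule ex_renaming2[OF assms ax])
  from f(3) show ?thesis by (simp add: f(1,2) del: One_nat_def)
qed

lemma comp_iff:
  assumes "i \<in> Vars n" "j \<in> Vars n" "k \<in> Vars n" "i \<noteq> j" "i \<noteq> k" "j \<noteq> k"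
  shows "\<turnstile> FIff (FAtom i (A \<^bold>; B) j) (FEx k (FAnd (FAtom i A k) (FAtom k B j)))"
proof -
  have ax: "\<turnstile> FIff (FAtom 0 (A \<^bold>; B) 1) (FEx 2 (FAnd (FAtom 0 A 2) (FAtom 2 B 1)))" (is "\<turnstile> ?\<phi>")
    by (intro derivable_axiom axioms_FO.comp) auto
  obtain f where f: "f 0 = i" "f 1 = j" "f 2 = k" "\<turnstile> rename_vars f ?\<phi>"
    by (rule ex_renaming[OF assms ax])
  from f(4) show ?thesis by (simp add: f(1-3) del: One_nat_def)
qed

text \<open>With these rules the simplifier settles inclusions in which the relative product is not
  taken apart.\<close>

lemma boolean_model_atoms [simp]:
  assumes "boolean_model w" "i \<in> Vars n" "j \<in> Vars n" "i \<noteq> j"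
  shows "FAtom i (A \<^bold>+ B) j \<in> w \<longleftrightarrow> FAtom i A j \<in> w \<or> FAtom i B j \<in> w"
    and "FAtom i (\<^bold>- A) j \<in> w \<longleftrightarrow> FAtom i A j \<notin> w"
    and "FAtom i (A\<^sup>\<smile>) j \<in> w \<longleftrightarrow> FAtom j A i \<in> w"
  using sum_iff[OF assms(2-4), THEN boolean_modelD[OF assms(1)], of A B]
    compl_iff[OF assms(2-4), THEN boolean_modelD[OF assms(1)], of A]
    conv_iff[OF assms(2-4), THEN boolean_modelD[OF assms(1)], of A]
  by (auto simp: boolean_model_simps[OF assms(1)])

text \<open>Here and in \<open>comp_elim\<close> the middle variable is explicit and the two factors
  are curried, so that later derivations never have to mention the quantifier hidden in the relative
  product.\<close>

lemma comp_intro: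
  assumes "i \<in> Vars n" "j \<in> Vars n" "k \<in> Vars n" "i \<noteq> j" "i \<noteq> k" "j \<noteq> k"
  shows "\<turnstile> FAtom i A k \<^bold>\<Rightarrow> FAtom k B j \<^bold>\<Rightarrow> FAtom i (A \<^bold>; B) j"
proof -
  have "\<turnstile> FAnd (FAtom i A k) (FAtom k B j) \<^bold>\<Rightarrow> FEx k (FAnd (FAtom i A k) (FAtom k B j))"
    using assms by (intro ex_intro) auto
  with comp_iff[OF assms, of A B] show ?thesis unfolding derivable_iff by auto
qed

lemma comp_elim:
  assumes "\<turnstile> FAtom i A k \<^bold>\<Rightarrow> FAtom k B j \<^bold>\<Rightarrow> \<phi>" "k \<notin> free_vars \<phi>"
    and "i \<noteq> j" "i \<noteq> k" "j \<noteq> k"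
  shows "\<turnstile> FAtom i (A \<^bold>; B) j \<^bold>\<Rightarrow> \<phi>"
proof -
  have v: "i \<in> Vars n" "j \<in> Vars n" "k \<in> Vars n" using derivable_Fms[OF assms(1)] by auto
  have "\<turnstile> FAnd (FAtom i A k) (FAtom k B j) \<^bold>\<Rightarrow> \<phi>"
    using assms(1) unfolding derivable_iff by auto
  then have "\<turnstile> FEx k (FAnd (FAtom i A k) (FAtom k B j)) \<^bold>\<Rightarrow> \<phi>"
    using v assms(2) by (rule_tac ex_elim) auto
  with comp_iff[OF v assms(3-5), of A B] show ?thesis unfolding derivable_iff by auto
qed

section \<open>Inclusion between predicates\<close>

definition included :: "rpred \<Rightarrow> rpred \<Rightarrow> bool" (infix "\<preceq>" 50) where
  "X \<preceq> Y \<longleftrightarrow> \<turnstile> FAtom 0 X 1 \<^bold>\<Rightarrow> FAtom 0 Y 1"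

lemma included_inst:
  assumes "X \<preceq> Y" "i \<in> Vars n" "j \<in> Vars n" "i \<noteq> j"
  shows "\<turnstile> FAtom i X j \<^bold>\<Rightarrow> FAtom i Y j"
proof -
  have "\<turnstile> FAtom 0 X 1 \<^bold>\<Rightarrow> FAtom 0 Y 1" (is "\<turnstile> ?\<phi>")
    using assms(1) by (simp add: included_def)
  then obtain f where f: "f 0 = i" "f 1 = j" "\<turnstile> rename_vars f ?\<phi>"
    by (rule ex_renaming2[OF assms(2-4)])
  from f(3) show ?thesis by (simp add: f(1,2) del: One_nat_def)
qed

lemma includedI:
  assumes "\<And>w i j. boolean_model w \<Longrightarrow> i \<in> Vars n \<Longrightarrow> j \<in> Vars n \<Longrightarrow> i \<noteq> j \<Longrightarrow>
    FAtom i X j \<in> w \<Longrightarrow> FAtom i Y j \<in> w"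
  shows "X \<preceq> Y"
  unfolding included_def derivable_iff using assms by auto

lemma includedD:
  "\<lbrakk>X \<preceq> Y; boolean_model w; FAtom i X j \<in> w; i \<in> Vars n; j \<in> Vars n; i \<noteq> j\<rbrakk> \<Longrightarrow> FAtom i Y j \<in> w"
  using included_inst[of X Y i j] unfolding derivable_iff by auto

lemma included_trans [trans]: "X \<preceq> Y \<Longrightarrow> Y \<preceq> Z \<Longrightarrow> X \<preceq> Z"
  using includedD[of X Y] includedD[of Y Z] by (intro includedI) auto

lemma included_compl_compl: "X \<preceq> \<^bold>- (\<^bold>- X)" and compl_compl_included: "\<^bold>- (\<^bold>- X) \<preceq> X"
  and included_refl: "X \<preceq> X"
  by (rule includedI; simp)+

lemma included_compl: "X \<preceq> Y \<Longrightarrow> \<^bold>- Y \<preceq> \<^bold>- X"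
  using includedD[of X Y] by (intro includedI) auto

lemma included_comp:
  assumes "X \<preceq> X'" "Y \<preceq> Y'"
  shows "X \<^bold>; Y \<preceq> X' \<^bold>; Y'"
proof -
  have "\<turnstile> FAtom 0 X 2 \<^bold>\<Rightarrow> FAtom 2 Y 1 \<^bold>\<Rightarrow> FAtom 0 (X' \<^bold>; Y') 1"
    using comp_intro[of 0 1 2 X' Y'] included_inst[OF assms(1), of 0 2]
      included_inst[OF assms(2), of 2 1]
    unfolding derivable_iff by auto
  then show ?thesis unfolding included_def by (rule comp_elim) auto
qed

text \<open>All four variables are in use at once: 2 is the point between \<open>X\<close> and the
  rest, 3 the point between \<open>Y\<close> and \<open>Z\<close>. While 3 is eliminated, the atom
  for \<open>X\<close> waits in the conclusion, in which 3 does not occur.\<close>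

lemma comp_assoc_left: "X \<^bold>; (Y \<^bold>; Z) \<preceq> (X \<^bold>; Y) \<^bold>; Z"
proof -
  have "\<turnstile> FAtom 2 Y 3 \<^bold>\<Rightarrow> FAtom 3 Z 1 \<^bold>\<Rightarrow> (FAtom 0 X 2 \<^bold>\<Rightarrow> FAtom 0 ((X \<^bold>; Y) \<^bold>; Z) 1)"
    using comp_intro[of 0 3 2 X Y] comp_intro[of 0 1 3 "X \<^bold>; Y" Z]
    unfolding derivable_iff by auto
  then have "\<turnstile> FAtom 2 (Y \<^bold>; Z) 1 \<^bold>\<Rightarrow> (FAtom 0 X 2 \<^bold>\<Rightarrow> FAtom 0 ((X \<^bold>; Y) \<^bold>; Z) 1)"
    by (rule comp_elim) auto
  then have "\<turnstile> FAtom 0 X 2 \<^bold>\<Rightarrow> FAtom 2 (Y \<^bold>; Z) 1 \<^bold>\<Rightarrow> FAtom 0 ((X \<^bold>; Y) \<^bold>; Z) 1"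
    unfolding derivable_iff by auto
  then show ?thesis unfolding included_def by (rule comp_elim) auto
qed

lemma comp_assoc_right: "(X \<^bold>; Y) \<^bold>; Z \<preceq> X \<^bold>; (Y \<^bold>; Z)"
proof -
  have "\<turnstile> FAtom 0 X 3 \<^bold>\<Rightarrow> FAtom 3 Y 2 \<^bold>\<Rightarrow> (FAtom 2 Z 1 \<^bold>\<Rightarrow> FAtom 0 (X \<^bold>; (Y \<^bold>; Z)) 1)"
    using comp_intro[of 3 1 2 Y Z] comp_intro[of 0 1 3 X "Y \<^bold>; Z"]
    unfolding derivable_iff by auto
  then have "\<turnstile> FAtom 0 (X \<^bold>; Y) 2 \<^bold>\<Rightarrow> (FAtom 2 Z 1 \<^bold>\<Rightarrow> FAtom 0 (X \<^bold>; (Y \<^bold>; Z)) 1)"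
    by (rule comp_elim) auto
  then show ?thesis unfolding included_def by (rule comp_elim) auto
qed

text \<open>Detachment, read at converses. If \<open>Y\<close> failed from 1 to 0, then 1 would be a
  middle point for the relative product of the converse of \<open>X\<close> with the complement of
  \<open>Y\<close> from 2 to 0, which the first factor excludes.\<close>

lemma comp_residual: "(\<^bold>- (X\<^sup>\<smile> \<^bold>; \<^bold>- Y))\<^sup>\<smile> \<^bold>; X\<^sup>\<smile> \<preceq> Y\<^sup>\<smile>"
proof -
  have "\<turnstile> FAtom 0 ((\<^bold>- (X\<^sup>\<smile> \<^bold>; \<^bold>- Y))\<^sup>\<smile>) 2 \<^bold>\<Rightarrow> FAtom 2 (X\<^sup>\<smile>) 1 \<^bold>\<Rightarrow> FAtom 0 (Y\<^sup>\<smile>) 1"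
    using comp_intro[of 2 0 1 "X\<^sup>\<smile>" "\<^bold>- Y"] unfolding derivable_iff by auto
  then show ?thesis unfolding included_def by (rule comp_elim) auto
qed

lemma eqn_iff: "\<turnstile> FIff (X \<^bold>\<doteq> Y) (univ_closure (FIff (FAtom 0 X 1) (FAtom 0 Y 1)))"
proof -
  have "univ_closure (FIff (FAtom 0 X 1) (FAtom 0 Y 1)) \<in> Fms n"
    by (simp add: univ_closure_def)
  then show ?thesis
    using provable_FO.ax[OF axioms_FO.eqn] by (simp add: derivable_def)
qed

lemma included_of_equation:
  assumes "(X \<^bold>\<doteq> Y) \<in> prov"
  shows "X \<preceq> Y" "Y \<preceq> X"
proof -
  let ?e = "FIff (FAtom 0 X 1) (FAtom 0 Y 1)"
  note eqn_iff[of X Y]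
  moreover have "\<turnstile> X \<^bold>\<doteq> Y" using assms by (simp add: derivable_def)
  ultimately have "\<turnstile> univ_closure ?e" unfolding derivable_iff by auto
  then have "\<turnstile> ?e" using derivable_univ_closure by blast
  then show "X \<preceq> Y" "Y \<preceq> X" unfolding included_def derivable_iff by auto
qed

lemma equation_of_included:
  assumes "X \<preceq> Y" "Y \<preceq> X"
  shows "(X \<^bold>\<doteq> Y) \<in> prov"
proof -
  let ?e = "FIff (FAtom 0 X 1) (FAtom 0 Y 1)"
  note eqn_iff[of X Y]
  moreover have "FAtom 0 X 1 \<in> w \<longleftrightarrow> FAtom 0 Y 1 \<in> w" if "boolean_model w" for w
    using includedD[OF assms(1) that, of 0 1] includedD[OF assms(2) that, of 0 1] by auto
  then have "\<turnstile> ?e" unfolding derivable_iff by auto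
  then have "\<turnstile> univ_closure ?e" using derivable_univ_closure by blast
  ultimately have "\<turnstile> X \<^bold>\<doteq> Y" unfolding derivable_iff by auto
  then show ?thesis by (simp add: derivable_def)
qed

text \<open>Suppose 0 and 1 are identical and 2 is a middle point for the product whose complement
  is \<open>?P\<close>. Then \<open>X\<close>, hence \<open>Y\<close>, holds from 2 to 0, so by
  Leibniz \<open>Y\<close> holds from 2 to 1, a contradiction. The atom \<open>FAtom 2 Y 0\<close>
  is chosen because interchanging 0 and 1 turns it into the one needed.\<close>

lemma truth_le_imp:
  assumes "X \<preceq> Y"
  shows "(\<^bold>1' \<^bold>\<le> (X \<^bold>\<rightarrow> Y)) \<in> prov"
proof -
  let ?P = "X \<^bold>\<rightarrow> Y"
  have "\<turnstile> FAtom 0 \<^bold>1' 1 \<^bold>\<Rightarrow> (FAtom 2 Y 0 \<^bold>\<Rightarrow> interchange 0 1 (FAtom 2 Y 0))"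
    using finite_n
    by (intro derivable_axiom axioms_FO.leibniz_fin) (auto simp: interchange_def)
  then have "\<turnstile> FAtom 0 (X\<^sup>\<smile>) 2 \<^bold>\<Rightarrow> FAtom 2 (\<^bold>- Y) 1 \<^bold>\<Rightarrow> \<^bold>\<not> FAtom 0 \<^bold>1' 1"
    using included_inst[OF assms, of 2 0] unfolding derivable_iff interchange_def by auto
  then have "\<turnstile> FAtom 0 (X\<^sup>\<smile> \<^bold>; \<^bold>- Y) 1 \<^bold>\<Rightarrow> \<^bold>\<not> FAtom 0 \<^bold>1' 1"
    by (rule comp_elim) auto
  then have "\<^bold>1' \<^bold>+ ?P \<preceq> ?P" unfolding included_def derivable_iff by auto
  moreover have "?P \<preceq> \<^bold>1' \<^bold>+ ?P" by (rule includedI) simp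
  ultimately show ?thesis by (rule equation_of_included)
qed

end

section \<open>The six inclusions from density and commutativity\<close>

locale dense_commutative_calculus = finite_fo_calculus +
  assumes \<Psi>_def: "\<Psi> = density_eqs \<union> commutativity_eqs"
begin

lemma dense: "X \<preceq> X \<^bold>; X"
proof -
  have "(X \<^bold>+ X \<^bold>; X \<^bold>\<doteq> X \<^bold>; X) \<in> prov"
    by (intro provable_FO.hyp) (auto simp: \<Psi>_def density_eqs_def)
  from includedD[OF included_of_equation(1)[OF this]] show ?thesis
    by (rule_tac includedI) auto
qed

lemma commute: "X \<^bold>; Y \<preceq> Y \<^bold>; X"
  by (intro included_of_equation provable_FO.hyp) (auto simp: \<Psi>_def commutativity_eqs_def)

text \<open>Density gives \<open>Z \<preceq> Z ; Z\<close>, and monotonicity enlarges the two copies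
  separately. With the hypothesis stated on atoms of boolean models, meets, converses and
  complements are left to the simplifier.\<close>

lemma dense_meet:
  assumes "\<And>w i j. \<lbrakk>boolean_model w; i \<in> Vars n; j \<in> Vars n; i \<noteq> j; FAtom i Z j \<in> w\<rbrakk>
    \<Longrightarrow> FAtom i X j \<in> w \<and> FAtom i Y j \<in> w"
  shows "Z \<preceq> X \<^bold>; Y"
proof -
  have "Z \<preceq> X" "Z \<preceq> Y" using assms by (auto intro: includedI)
  with included_trans[OF dense included_comp] show ?thesis by blast
qed

lemma reductio: "(\<^bold>1' \<^bold>\<le> ((A \<^bold>\<rightarrow> \<^bold>\<sim> A) \<^bold>\<rightarrow> \<^bold>\<sim> A)) \<in> prov"
  by (intro truth_le_imp included_compl dense_meet) auto

lemma meet_le_fusion: "(\<^bold>1' \<^bold>\<le> (A \<^bold>\<and> B \<^bold>\<rightarrow> A \<^bold>\<circ> B)) \<in> prov"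
  by (intro truth_le_imp dense_meet) auto

lemma imp_le_or: "(\<^bold>1' \<^bold>\<le> ((A \<^bold>\<rightarrow> B) \<^bold>\<rightarrow> \<^bold>\<sim> A \<^bold>\<or> B)) \<in> prov"
proof (rule truth_le_imp)
  have "A\<^sup>\<smile> \<^bold>\<and> \<^bold>- B \<preceq> A\<^sup>\<smile> \<^bold>; \<^bold>- B" by (rule dense_meet) auto
  from includedD[OF this] show "(A \<^bold>\<rightarrow> B) \<preceq> \<^bold>\<sim> A \<^bold>\<or> B"
    by (rule_tac includedI) auto
qed

lemma meet_importation: "(\<^bold>1' \<^bold>\<le> ((A \<^bold>\<rightarrow> (B \<^bold>\<rightarrow> C)) \<^bold>\<rightarrow> (A \<^bold>\<and> B \<^bold>\<rightarrow> C))) \<in> prov"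
proof (intro truth_le_imp included_compl)
  have "(A \<^bold>\<and> B)\<^sup>\<smile> \<^bold>; \<^bold>- C \<preceq> (A\<^sup>\<smile> \<^bold>; B\<^sup>\<smile>) \<^bold>; \<^bold>- C"
    by (intro included_comp included_refl dense_meet) auto
  also have "\<dots> \<preceq> A\<^sup>\<smile> \<^bold>; (B\<^sup>\<smile> \<^bold>; \<^bold>- C)" by (rule comp_assoc_right)
  also have "\<dots> \<preceq> A\<^sup>\<smile> \<^bold>; \<^bold>- (\<^bold>- (B\<^sup>\<smile> \<^bold>; \<^bold>- C))"
    by (intro included_comp included_refl included_compl_compl)
  finally show "(A \<^bold>\<and> B)\<^sup>\<smile> \<^bold>; \<^bold>- C \<preceq> A\<^sup>\<smile> \<^bold>; \<^bold>- (B \<^bold>\<rightarrow> C)" .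
qed

lemma contraction: "(\<^bold>1' \<^bold>\<le> ((A \<^bold>\<rightarrow> (A \<^bold>\<rightarrow> B)) \<^bold>\<rightarrow> (A \<^bold>\<rightarrow> B))) \<in> prov"
proof (intro truth_le_imp included_compl)
  have "A\<^sup>\<smile> \<^bold>; \<^bold>- B \<preceq> (A\<^sup>\<smile> \<^bold>; A\<^sup>\<smile>) \<^bold>; \<^bold>- B"
    by (intro included_comp included_refl dense)
  also have "\<dots> \<preceq> A\<^sup>\<smile> \<^bold>; (A\<^sup>\<smile> \<^bold>; \<^bold>- B)" by (rule comp_assoc_right)
  also have "\<dots> \<preceq> A\<^sup>\<smile> \<^bold>; \<^bold>- (\<^bold>- (A\<^sup>\<smile> \<^bold>; \<^bold>- B))"
    by (intro included_comp included_refl included_compl_compl)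
  finally show "A\<^sup>\<smile> \<^bold>; \<^bold>- B \<preceq> A\<^sup>\<smile> \<^bold>; \<^bold>- (A \<^bold>\<rightarrow> B)" .
qed

text \<open>Density provides two copies of the converse of \<open>A\<close>. Residuation spends the
  left one on \<open>A \<rightarrow> B\<close> and leaves the converse of \<open>B\<close> in front
  of the other, whereas the target has the converse of \<open>A\<close> outermost; commutativity
  makes this exchange.\<close>

lemma self_distribution:
  "(\<^bold>1' \<^bold>\<le> ((A \<^bold>\<rightarrow> (B \<^bold>\<rightarrow> C)) \<^bold>\<rightarrow> ((A \<^bold>\<rightarrow> B) \<^bold>\<rightarrow> (A \<^bold>\<rightarrow> C)))) \<in> prov"
proof (intro truth_le_imp included_compl)
  let ?D = "(A \<^bold>\<rightarrow> B)\<^sup>\<smile>" and ?a = "A\<^sup>\<smile>" and ?b = "B\<^sup>\<smile>" and ?c = "\<^bold>- C"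
  have "?D \<^bold>; \<^bold>- (A \<^bold>\<rightarrow> C) \<preceq> ?D \<^bold>; (?a \<^bold>; ?c)"
    by (intro included_comp included_refl compl_compl_included)
  also have "\<dots> \<preceq> ?D \<^bold>; ((?a \<^bold>; ?a) \<^bold>; ?c)"
    by (intro included_comp included_refl dense)
  also have "\<dots> \<preceq> ?D \<^bold>; (?a \<^bold>; (?a \<^bold>; ?c))"
    by (intro included_comp included_refl comp_assoc_right)
  also have "\<dots> \<preceq> (?D \<^bold>; ?a) \<^bold>; (?a \<^bold>; ?c)" by (rule comp_assoc_left)
  also have "\<dots> \<preceq> ?b \<^bold>; (?a \<^bold>; ?c)" by (intro included_comp included_refl comp_residual)
  also have "\<dots> \<preceq> (?b \<^bold>; ?a) \<^bold>; ?c" by (rule comp_assoc_left)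
  also have "\<dots> \<preceq> (?a \<^bold>; ?b) \<^bold>; ?c" by (intro included_comp included_refl commute)
  also have "\<dots> \<preceq> ?a \<^bold>; (?b \<^bold>; ?c)" by (rule comp_assoc_right)
  also have "\<dots> \<preceq> ?a \<^bold>; \<^bold>- (\<^bold>- (?b \<^bold>; ?c))"
    by (intro included_comp included_refl included_compl_compl)
  finally show "?D \<^bold>; \<^bold>- (A \<^bold>\<rightarrow> C) \<preceq> ?a \<^bold>; \<^bold>- (B \<^bold>\<rightarrow> C)" .
qed

end

section \<open>Soundness in relational models\<close>

text \<open>Models whose unit is a full square suffice, since the relations obtained from a group
  live in a single block. \<open>U\<close> may be a proper part of its type, so quantifiers and
  assignments are relativized to it.\<close>

locale rel_interpretation =
  fixes U :: "'u set" and h :: "rpred \<Rightarrow> ('u \<times> 'u) set"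
  assumes h_subset: "h A \<subseteq> U \<times> U"
    and h_one: "h \<^bold>1' = Id_on U"
    and h_add: "h (A \<^bold>+ B) = h A \<union> h B"
    and h_compl: "h (\<^bold>- A) = U \<times> U - h A"
    and h_comp: "h (A \<^bold>; B) = h A O h B"
    and h_conv: "h (A\<^sup>\<smile>) = (h A)\<inverse>"
begin

primrec sat :: "fm \<Rightarrow> (nat \<Rightarrow> 'u) \<Rightarrow> bool" where
  "sat (FAtom x A y) e \<longleftrightarrow> (e x, e y) \<in> h A"
| "sat (A \<^bold>\<doteq> B) e \<longleftrightarrow> h A = h B"
| "sat (\<phi> \<^bold>\<Rightarrow> \<psi>) e \<longleftrightarrow> (sat \<phi> e \<longrightarrow> sat \<psi> e)"
| "sat (\<^bold>\<not> \<phi>) e \<longleftrightarrow> \<not> sat \<phi> e"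
| "sat (FAll x \<phi>) e \<longleftrightarrow> (\<forall>u\<in>U. sat \<phi> (e(x := u)))"

lemma sat_FIff: "sat (FIff \<phi> \<psi>) e \<longleftrightarrow> (sat \<phi> e \<longleftrightarrow> sat \<psi> e)"
  by auto

definition valid :: "fm \<Rightarrow> bool" where
  "valid \<phi> \<longleftrightarrow> (\<forall>e. range e \<subseteq> U \<longrightarrow> sat \<phi> e)"

lemma sat_cong: "(\<And>x. x \<in> free_vars \<phi> \<Longrightarrow> e x = e' x) \<Longrightarrow> sat \<phi> e \<longleftrightarrow> sat \<phi> e'"
proof (induction \<phi> arbitrary: e e')
  case (FAll x \<phi>)
  have "sat \<phi> (e(x := u)) \<longleftrightarrow> sat \<phi> (e'(x := u))" for u
    using FAll.prems by (intro FAll.IH) auto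
  then show ?case by simp
next
  case (FImp \<phi> \<psi>)
  have "sat \<phi> e \<longleftrightarrow> sat \<phi> e'" using FImp.prems by (intro FImp.IH(1)) simp
  moreover have "sat \<psi> e \<longleftrightarrow> sat \<psi> e'" using FImp.prems by (intro FImp.IH(2)) simp
  ultimately show ?case by simp
next
  case (FNeg \<phi>)
  have "sat \<phi> e \<longleftrightarrow> sat \<phi> e'" using FNeg.prems by (intro FNeg.IH) simp
  then show ?case by simp
qed auto

lemma range_update: "range e \<subseteq> U \<Longrightarrow> u \<in> U \<Longrightarrow> range (e(x := u)) \<subseteq> U"
  by auto

lemma valid_univ_closure:
  assumes "valid \<phi>"
  shows "valid (univ_closure \<phi>)"
proof -
  have "valid (foldr FAll xs \<phi>)" for xs
    using assms by (induction xs) (auto simp: valid_def range_update simp del: fun_upd_apply)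
  then show ?thesis by (simp add: univ_closure_def)
qed

lemma valid_axiom:
  assumes "\<phi> \<in> axioms_FO \<infinity>"
  shows "valid \<phi>"
  using assms
proof cases
  case (all_comm \<phi> x y)
  have "sat (FAll x (FAll y \<phi>) \<^bold>\<Rightarrow> FAll y (FAll x \<phi>)) e" for e
    by (cases "x = y") (auto simp: fun_upd_twist)
  then show ?thesis unfolding all_comm(1) by (intro valid_univ_closure) (simp add: valid_def)
next
  case (all_elim \<phi> x)
  have "sat (FAll x \<phi> \<^bold>\<Rightarrow> \<phi>) e" if "range e \<subseteq> U" for e
    using bspec[of U "\<lambda>u. sat \<phi> (e(x := u))" "e x"] that by auto
  then show ?thesis unfolding all_elim(1) by (intro valid_univ_closure) (simp add: valid_def)
next
  case (all_vacuous \<phi> x)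
  have "sat \<phi> (e(x := u)) \<longleftrightarrow> sat \<phi> e" for e u
    using all_vacuous by (intro sat_cong) auto
  then show ?thesis unfolding all_vacuous(1) by (intro valid_univ_closure) (simp add: valid_def)
next
  case (ex_eq x y)
  have "sat (FEx x (FAtom x \<^bold>1' y)) e" if "range e \<subseteq> U" for e
    using ex_eq that by (auto simp: h_one intro!: bexI[of _ "e y"])
  then show ?thesis unfolding ex_eq(1) by (intro valid_univ_closure) (simp add: valid_def)
next
  case (leibniz_omega \<phi> x y \<psi>)
  then show ?thesis unfolding leibniz_omega(1)
    by (intro valid_univ_closure) (auto simp: valid_def h_one elim!: replaces_one.cases)
next
  case (comp A B)
  have "sat (FIff (FAtom 0 (A \<^bold>; B) 1) (FEx 2 (FAnd (FAtom 0 A 2) (FAtom 2 B 1)))) e" for e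
    using h_subset[of A] by (auto simp: h_comp)
  then show ?thesis unfolding comp by (intro valid_univ_closure) (simp add: valid_def)
next
  case (compl A)
  have "sat (FIff (FAtom 0 (\<^bold>- A) 1) (\<^bold>\<not> FAtom 0 A 1)) e" if "range e \<subseteq> U" for e
    using that by (auto simp: h_compl)
  then show ?thesis unfolding compl by (intro valid_univ_closure) (simp add: valid_def)
next
  case (eqn A B)
  let ?c = "univ_closure (FIff (FAtom 0 A 1) (FAtom 0 B 1))"
  have c: "?c = FAll 0 (FAll 1 (FIff (FAtom 0 A 1) (FAtom 0 B 1)))"
    by (simp add: univ_closure_def)
  have "sat ?c e \<longleftrightarrow> (\<forall>u\<in>U. \<forall>v\<in>U. (u, v) \<in> h A \<longleftrightarrow> (u, v) \<in> h B)" for e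
    unfolding c sat.simps(5) sat_FIff by simp
  \<comment> \<open>The axiom for an equation compares only pairs from \<open>U\<close>; as all
    relations are included in the square of \<open>U\<close>, this determines them.\<close>
  moreover have "h A = h B \<longleftrightarrow> (\<forall>u\<in>U. \<forall>v\<in>U. (u, v) \<in> h A \<longleftrightarrow> (u, v) \<in> h B)"
    using h_subset[of A] h_subset[of B] by blast
  ultimately show ?thesis unfolding eqn valid_def sat_FIff sat.simps(2) by simp
next
  case (leibniz_fin \<phi> x y)
  then show ?thesis by simp
next
  case (trans \<phi> \<psi> \<xi>)
  then show ?thesis unfolding trans(1) by (intro valid_univ_closure) (simp add: valid_def)
next
  case (clavius \<phi>)
  then show ?thesis unfolding clavius(1) by (intro valid_univ_closure) (simp add: valid_def)
next
  case (duns \<phi> \<psi>)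
  then show ?thesis unfolding duns(1) by (intro valid_univ_closure) (simp add: valid_def)
next
  case (all_imp \<phi> \<psi> x)
  then show ?thesis unfolding all_imp(1) by (intro valid_univ_closure) (simp add: valid_def)
next
  case (sum A B)
  then show ?thesis unfolding sum by (intro valid_univ_closure) (auto simp add: valid_def h_add)
next
  case (conv A)
  then show ?thesis unfolding conv by (intro valid_univ_closure) (simp add: valid_def h_conv)
qed

lemma soundness:
  assumes "\<phi> \<in> provable_FO \<infinity> \<Psi>" "\<And>\<psi>. \<psi> \<in> \<Psi> \<Longrightarrow> valid \<psi>"
  shows "valid \<phi>"
  using assms(1)
proof induction
  case (mp \<phi> \<psi>)
  then show ?case by (simp add: valid_def)
qed (simp_all add: assms(2) valid_axiom)

section \<open>Soundness of the sequent calculus\<close>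

definition seq_sat :: "seq_fms \<Rightarrow> seq_fms \<Rightarrow> (nat \<Rightarrow> 'u) \<Rightarrow> bool" where
  "seq_sat \<Gamma> \<Delta> e \<longleftrightarrow>
    ((\<forall>(x, A, y)\<in>\<Gamma>. (e x, e y) \<in> h A) \<longrightarrow> (\<exists>(x, A, y)\<in>\<Delta>. (e x, e y) \<in> h A))"

text \<open>The assignment is generalized in the induction because the left rule for the relative
  product uses its premise at a changed assignment.\<close>

lemma seq_soundness:
  assumes "(\<Gamma>, \<Delta>) \<in> provable_seq \<Xi>" "\<And>X Y. (X \<^bold>\<doteq> Y) \<in> \<Xi> \<Longrightarrow> h X = h Y" "range e \<subseteq> U"
  shows "seq_sat \<Gamma> \<Delta> e"
  using assms(1,3)
proof (induction arbitrary: e)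
  case (comp_l x A y B z \<Gamma> \<Delta>)
  show ?case
    unfolding seq_sat_def
  proof
    assume *: "\<forall>(x, A, y)\<in>insert (x, A \<^bold>; B, z) \<Gamma>. (e x, e y) \<in> h A"
    then obtain u where u: "(e x, u) \<in> h A" "(u, e z) \<in> h B" by (auto simp: h_comp)
    then have "u \<in> U" using h_subset by blast
    \<comment> \<open>The eigenvariable \<open>y\<close> is sent to the middle point
      \<open>u\<close>; its freshness leaves the truth of all side formulas unchanged.\<close>
    let ?e = "e(y := u)"
    have same: "?e x' = e x' \<and> ?e y' = e y'" if "(x', C, y') \<in> \<Gamma> \<union> \<Delta>" for x' C y'
      using that comp_l.hyps(4) by (auto simp: seq_vars_def)
    have "seq_sat (insert (x, A, y) (insert (y, B, z) \<Gamma>)) \<Delta> ?e"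
      by (rule comp_l.IH[OF range_update[OF comp_l.prems \<open>u \<in> U\<close>]])
    moreover have "\<forall>(x', C, y')\<in>insert (x, A, y) (insert (y, B, z) \<Gamma>). (?e x', ?e y') \<in> h C"
    proof (safe, goal_cases)
      case 1 then show ?case using u comp_l.hyps by simp
    next
      case 2 then show ?case using u comp_l.hyps by simp
    next
      case (3 x' C y')
      then have "(e x', e y') \<in> h C" using * by auto
      then show ?case using same[of x' C y'] 3 by simp
    qed
    ultimately obtain x' C y' where "(x', C, y') \<in> \<Delta>" "(?e x', ?e y') \<in> h C"
      unfolding seq_sat_def by blast
    moreover from this have "(e x', e y') \<in> h C" using same[of x' C y'] by simp
    ultimately show "\<exists>(x, A, y)\<in>\<Delta>. (e x, e y) \<in> h A" by blast
  qed
next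
  case (cut \<Gamma> x A y \<Delta> \<Gamma>' \<Delta>')
  show ?case using cut.IH(1)[OF cut.prems] cut.IH(2)[OF cut.prems]
    unfolding seq_sat_def by (simp add: ball_Un bex_Un) blast
next
  case (comp_r \<Gamma> x A y \<Delta> \<Gamma>' B z \<Delta>')
  show ?case using comp_r.IH(1)[OF comp_r.prems] comp_r.IH(2)[OF comp_r.prems]
    unfolding seq_sat_def by (simp add: ball_Un bex_Un h_comp) blast
next
  case (sum_l x A y \<Gamma> \<Delta> B \<Gamma>' \<Delta>')
  show ?case using sum_l.IH(1)[OF sum_l.prems] sum_l.IH(2)[OF sum_l.prems]
    unfolding seq_sat_def by (simp add: ball_Un bex_Un h_add) blast
next
  case (sum_r \<Gamma> x A y B \<Delta>)
  show ?case using sum_r.IH[OF sum_r.prems]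
    unfolding seq_sat_def by (simp add: h_add)
next
  case (compl_l \<Gamma> x A y \<Delta>)
  show ?case using compl_l.IH[OF compl_l.prems]
    unfolding seq_sat_def by (simp add: h_compl) blast
next
  case (compl_r x A y \<Gamma> \<Delta>)
  have "e x \<in> U" "e y \<in> U" using compl_r.prems by auto
  then show ?case using compl_r.IH[OF compl_r.prems]
    unfolding seq_sat_def by (simp add: h_compl)
next
  case (ax \<Gamma> \<Delta>)
  then obtain x A y where "(x, A, y) \<in> \<Gamma>" "(x, A, y) \<in> \<Delta>" by (metis disjoint_iff prod_cases3)
  then show ?case unfolding seq_sat_def by (intro impI bexI[of _ "(x, A, y)"]) auto
next
  case (ax_id x \<Delta> \<Gamma>)
  have "(e x, e x) \<in> h \<^bold>1'" using ax_id.prems by (auto simp: h_one)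
  then show ?case
    using ax_id.hyps unfolding seq_sat_def by (intro impI bexI[of _ "(x, \<^bold>1', x)"]) simp_all
next
  case (equality x A y \<Gamma> \<Delta> z)
  show ?case using equality.IH[OF equality.prems] unfolding seq_sat_def by (auto simp: h_one)
next
  case (conv_l x A y \<Gamma> \<Delta>)
  show ?case using conv_l.IH[OF conv_l.prems] unfolding seq_sat_def by (simp add: h_conv)
next
  case (conv_r \<Gamma> x A y \<Delta>)
  show ?case using conv_r.IH[OF conv_r.prems] unfolding seq_sat_def by (simp add: h_conv)
next
  case (eqn_lr X Y i j \<Gamma> \<Delta>)
  then show ?case unfolding seq_sat_def using assms(2)[OF eqn_lr.hyps] by simp
next
  case (eqn_rl X Y i j \<Gamma> \<Delta>)
  then show ?case unfolding seq_sat_def using assms(2)[OF eqn_rl.hyps] by simp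
qed

end

section \<open>Complex algebras of groups\<close>

context group
begin

text \<open>The Cayley graph with connection set \<open>X\<close>, a relation invariant under left
  translations. Dividing by the first point on the left makes labels multiply in the order in which
  edges are composed.\<close>

definition cayley :: "'a set \<Rightarrow> ('a \<times> 'a) set" where
  "cayley X = {(x, y). x \<in> carrier G \<and> y \<in> carrier G \<and> inv x \<otimes> y \<in> X}"

lemma cayley_subset: "cayley X \<subseteq> carrier G \<times> carrier G"
  by (auto simp: cayley_def)

lemma cayley_Un: "cayley (X \<union> Y) = cayley X \<union> cayley Y"
  by (auto simp: cayley_def)

lemma cayley_Diff: "cayley (carrier G - X) = carrier G \<times> carrier G - cayley X"
  by (auto simp: cayley_def)

lemma cayley_one: "cayley {\<one>} = Id_on (carrier G)"
proof -
  have "inv x \<otimes> y = \<one> \<longleftrightarrow> y = x" if "x \<in> carrier G" "y \<in> carrier G" for x y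
    using inv_solve_left[of \<one> x y] that by (metis one_closed r_one)
  then show ?thesis by (auto simp: cayley_def)
qed

lemma cayley_inv:
  assumes "X \<subseteq> carrier G"
  shows "cayley ((\<lambda>x. inv x) ` X) = (cayley X)\<inverse>"
proof -
  have "inv x \<otimes> y \<in> (\<lambda>x. inv x) ` X \<longleftrightarrow> inv y \<otimes> x \<in> X"
    if "x \<in> carrier G" "y \<in> carrier G" for x y
  proof -
    have e: "inv (inv x \<otimes> y) = inv y \<otimes> x" "inv (inv y \<otimes> x) = inv x \<otimes> y"
      using that by (simp_all add: inv_mult_group)
    show ?thesis
    proof
      assume "inv x \<otimes> y \<in> (\<lambda>x. inv x) ` X"
      then obtain z where "z \<in> X" "inv x \<otimes> y = inv z" by blast
      then show "inv y \<otimes> x \<in> X" using assms e(1) by (metis inv_inv subsetD)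
    next
      assume "inv y \<otimes> x \<in> X"
      then show "inv x \<otimes> y \<in> (\<lambda>x. inv x) ` X" using e(2) by (metis imageI)
    qed
  qed
  then show ?thesis by (auto simp: cayley_def)
qed

text \<open>An edge from \<open>a\<close> labelled \<open>x \<otimes> y\<close> is split at the
  point \<open>a \<otimes> x\<close>; conversely, the middle point cancels when two labels are
  multiplied.\<close>

lemma cayley_comp:
  assumes "X \<subseteq> carrier G" "Y \<subseteq> carrier G"
  shows "cayley {z. \<exists>x\<in>X. \<exists>y\<in>Y. x \<in> carrier G \<and> y \<in> carrier G \<and> z \<in> carrier G \<and> x \<otimes> y = z} =
    cayley X O cayley Y" (is "cayley ?P = _")
proof (intro equalityI subrelI)
  fix a b assume "(a, b) \<in> cayley ?P"
  then obtain x y where xy: "a \<in> carrier G" "b \<in> carrier G" "x \<in> X" "y \<in> Y" "x \<otimes> y = inv a \<otimes> b"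
    by (auto simp: cayley_def)
  have c: "x \<in> carrier G" "y \<in> carrier G" using xy assms by auto
  have "inv a \<otimes> (a \<otimes> x) = x" using xy c by (simp add: m_assoc[symmetric])
  moreover have "b = (a \<otimes> x) \<otimes> y" using xy c by (simp add: m_assoc) (simp add: m_assoc[symmetric])
  moreover have "inv d \<otimes> (d \<otimes> y) = y" if "d \<in> carrier G" for d
    using that c by (simp add: m_assoc[symmetric])
  ultimately have "inv a \<otimes> (a \<otimes> x) = x" "inv (a \<otimes> x) \<otimes> b = y" using xy(1) c by auto
  then have "(a, a \<otimes> x) \<in> cayley X" "(a \<otimes> x, b) \<in> cayley Y"
    using xy c by (auto simp: cayley_def)
  then show "(a, b) \<in> cayley X O cayley Y" by blast
next
  fix a b assume "(a, b) \<in> cayley X O cayley Y"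
  then obtain c where c: "(a, c) \<in> cayley X" "(c, b) \<in> cayley Y" by blast
  then have mem: "inv a \<otimes> c \<in> X" "inv c \<otimes> b \<in> Y"
    and ab: "a \<in> carrier G" "b \<in> carrier G" and "c \<in> carrier G"
    by (auto simp: cayley_def)
  have "c \<otimes> (inv c \<otimes> b) = b"
    using ab \<open>c \<in> carrier G\<close> by (simp add: m_assoc[symmetric])
  then have eq: "(inv a \<otimes> c) \<otimes> (inv c \<otimes> b) = inv a \<otimes> b"
    using ab \<open>c \<in> carrier G\<close> by (simp add: m_assoc)
  have "inv a \<otimes> b \<in> ?P"
    by (rule CollectI, rule bexI[OF _ mem(1)], rule bexI[OF _ mem(2)])
       (use ab \<open>c \<in> carrier G\<close> eq in simp)
  then show "(a, b) \<in> cayley ?P" using ab by (simp add: cayley_def)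
qed

text \<open>The set is recovered as the set of successors of \<one>.\<close>

lemma cayley_inj: "inj_on cayley (Pow (carrier G))"
proof (rule inj_onI)
  fix X Y assume "X \<in> Pow (carrier G)" "Y \<in> Pow (carrier G)" "cayley X = cayley Y"
  moreover have "z \<in> Z \<longleftrightarrow> (\<one>, z) \<in> cayley Z" if "z \<in> carrier G" for z Z
    using that by (simp add: cayley_def)
  ultimately show "X = Y" by blast
qed

text \<open>Through this, a single valuation in the frame serves as a countermodel for both
  calculi.\<close>

lemma group_hom_interpretation:
  assumes "h \<in> ra_hom pred_alg (complex_algebra (group_frame G))"
  shows "rel_interpretation (carrier G) (\<lambda>A. cayley (h A))"
proof
  have h: "h A \<subseteq> carrier G" for A
    using assms by (auto simp: ra_hom_def pred_alg_def complex_algebra_def group_frame_def)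
  show "cayley (h A) \<subseteq> carrier G \<times> carrier G" for A by (rule cayley_subset)
  show "cayley (h \<^bold>1') = Id_on (carrier G)"
    using assms
    by (simp add: ra_hom_def pred_alg_def complex_algebra_def group_frame_def cayley_one)
  show "cayley (h (A \<^bold>+ B)) = cayley (h A) \<union> cayley (h B)" for A B
    using assms
    by (simp add: ra_hom_def pred_alg_def complex_algebra_def group_frame_def cayley_Un)
  show "cayley (h (\<^bold>- A)) = carrier G \<times> carrier G - cayley (h A)" for A
    using assms
    by (simp add: ra_hom_def pred_alg_def complex_algebra_def group_frame_def cayley_Diff)
  show "cayley (h (A \<^bold>; B)) = cayley (h A) O cayley (h B)" for A B
    using assms cayley_comp[OF h h, of A B]
    by (simp add: ra_hom_def pred_alg_def complex_algebra_def group_frame_def)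
  show "cayley (h (A\<^sup>\<smile>)) = (cayley (h A))\<inverse>" for A
    using assms cayley_inv[OF h, of A]
    by (simp add: ra_hom_def pred_alg_def complex_algebra_def group_frame_def)
qed

end

text \<open>Spares a direct check that the algebra of transported relations is closed under its
  operations.\<close>

lemma is_algebra_hom_image:
  assumes A: "is_algebra \<AA>" and h: "h \<in> ra_hom \<AA> \<BB>" and univ: "ra_univ \<BB> = h ` ra_univ \<AA>"
  shows "is_algebra \<BB>"
  unfolding is_algebra_def univ
proof (intro conjI ballI)
  fix X assume "X \<in> h ` ra_univ \<AA>"
  then obtain x where x: "x \<in> ra_univ \<AA>" "X = h x" by blast
  have "ra_compl \<AA> x \<in> ra_univ \<AA>" "ra_compl \<BB> X = h (ra_compl \<AA> x)"
    using A h x by (simp_all add: is_algebra_def ra_hom_def)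
  then show "ra_compl \<BB> X \<in> h ` ra_univ \<AA>" by simp
  have "ra_conv \<AA> x \<in> ra_univ \<AA>" "ra_conv \<BB> X = h (ra_conv \<AA> x)"
    using A h x by (simp_all add: is_algebra_def ra_hom_def)
  then show "ra_conv \<BB> X \<in> h ` ra_univ \<AA>" by simp
  fix Y assume "Y \<in> h ` ra_univ \<AA>"
  then obtain y where y: "y \<in> ra_univ \<AA>" "Y = h y" by blast
  have "ra_plus \<AA> x y \<in> ra_univ \<AA>" "ra_plus \<BB> X Y = h (ra_plus \<AA> x y)"
    using A h x y by (simp_all add: is_algebra_def ra_hom_def)
  then show "ra_plus \<BB> X Y \<in> h ` ra_univ \<AA>" by simp
  have "ra_comp \<AA> x y \<in> ra_univ \<AA>" "ra_comp \<BB> X Y = h (ra_comp \<AA> x y)"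
    using A h x y by (simp_all add: is_algebra_def ra_hom_def)
  then show "ra_comp \<BB> X Y \<in> h ` ra_univ \<AA>" by simp
next
  have "ra_one \<AA> \<in> ra_univ \<AA>" "ra_one \<BB> = h (ra_one \<AA>)"
    using A h by (simp_all add: is_algebra_def ra_hom_def)
  then show "ra_one \<BB> \<in> h ` ra_univ \<AA>" by simp
qed

context group
begin

lemma is_algebra_complex_algebra: "is_algebra (complex_algebra (group_frame G))"
  by (auto simp: is_algebra_def complex_algebra_def group_frame_def)

lemma representable_complex_algebra:
  "representable_relation_algebra (complex_algebra (group_frame G))"
proof -
  \<comment> \<open>Elements of the complex algebra have type \<open>'a set\<close>, so
    representability asks for points of type \<open>'a set + nat\<close>; singletons embed the group
    there.\<close>
  define f :: "'a \<Rightarrow> 'a set + nat" where "f x = Inl {x}" for x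
  define F where "F = image (map_prod f f)"
  have f: "inj f" by (auto simp: f_def inj_def)
  then have inj_ff: "inj (map_prod f f)" by (simp add: prod.inj_map)
  then have inj_F: "inj F" unfolding F_def by (intro injI) (simp add: inj_image_eq_iff)
  have F_Un: "F (X \<union> Y) = F X \<union> F Y" for X Y by (auto simp: F_def)
  \<comment> \<open>Differences and relative products pass through \<open>F\<close> because
    \<open>f\<close> is injective; for products, the two images of the middle point have to
    match.\<close>
  have F_Diff: "F (X - Y) = F X - F Y" for X Y
    unfolding F_def using inj_ff by (rule image_set_diff)
  have F_comp: "F (X O Y) = F X O F Y" for X Y
    using f by (fastforce simp: F_def dest: injD)
  have F_conv: "F (X\<inverse>) = (F X)\<inverse>" for X by (auto simp: F_def)
  let ?C = "complex_algebra (group_frame G)" and ?K = "carrier G"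
  define H where "H X = F (cayley X)" for X
  define E where "E = H ?K"
  define B where "B = \<lparr>ra_univ = H ` Pow ?K, ra_plus = (\<union>), ra_compl = (\<lambda>X. E - X),
    ra_comp = (O), ra_conv = (\<lambda>X. X\<inverse>), ra_one = F (Id_on ?K)\<rparr>"
  have K: "cayley ?K = ?K \<times> ?K" by (auto simp: cayley_def)
  have univ: "ra_univ ?C = Pow ?K" by (simp add: complex_algebra_def group_frame_def)
  have hom: "H \<in> ra_hom ?C B"
    unfolding ra_hom_def univ
  proof (intro CollectI conjI ballI)
    fix X assume X: "X \<in> Pow ?K"
    show "H X \<in> ra_univ B" using X by (simp add: B_def)
    show "H (ra_plus ?C X Y) = ra_plus B (H X) (H Y)" for Y
      by (simp add: complex_algebra_def B_def H_def cayley_Un F_Un)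
    show "H (ra_compl ?C X) = ra_compl B (H X)"
      by (simp add: complex_algebra_def group_frame_def B_def E_def H_def cayley_Diff F_Diff K)
    show "H (ra_comp ?C X Y) = ra_comp B (H X) (H Y)" if "Y \<in> Pow ?K" for Y
      using X that cayley_comp[of X Y]
      by (simp add: complex_algebra_def group_frame_def B_def H_def F_comp)
    show "H (ra_conv ?C X) = ra_conv B (H X)"
      using X cayley_inv[of X]
      by (simp add: complex_algebra_def group_frame_def B_def H_def F_conv)
  next
    show "H (ra_one ?C) = ra_one B"
      by (simp add: complex_algebra_def group_frame_def B_def H_def cayley_one)
  qed
  have "inj_on H (Pow ?K)"
    unfolding H_def using comp_inj_on[OF cayley_inj inj_on_subset[OF inj_F]] by (simp add: comp_def)
  then have iso: "ra_isomorphic ?C B"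
    unfolding ra_isomorphic_def using hom univ by (auto simp: bij_betw_def B_def)
  have alg: "is_algebra B"
    by (rule is_algebra_hom_image[OF is_algebra_complex_algebra hom]) (simp add: univ, simp add: B_def)
  have E: "E = f ` ?K \<times> f ` ?K" by (auto simp: E_def H_def K F_def)
  have "proper_relation_algebra B"
    unfolding proper_relation_algebra_def
  proof (intro conjI bexI[of _ E] alg ballI)
    show "equiv (Field E) E"
      unfolding E by (auto simp: Field_def equiv_def refl_on_def sym_def trans_def)
    show "X \<subseteq> E" if "X \<in> ra_univ B" for X
    proof -
      obtain Y where Y: "X = H Y" "Y \<subseteq> ?K" using \<open>X \<in> ra_univ B\<close> by (auto simp: B_def)
      then have "cayley Y \<subseteq> cayley ?K" by (auto simp: cayley_def)
      then show ?thesis unfolding Y(1) E_def H_def F_def by blast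
    qed
    show "E \<in> ra_univ B" by (simp add: B_def E_def)
    show "ra_one B = {(x, x) |x. (x, x) \<in> E}" by (auto simp: B_def E F_def Id_on_def)
  qed (simp_all add: B_def)
  then show ?thesis
    unfolding representable_relation_algebra_def using iso is_algebra_complex_algebra by blast
qed

end

text \<open>The predicates form an absolutely free algebra, so a valuation of the variables has
  exactly one homomorphic extension; this is its value.\<close>

primrec frame_val :: "'a frame \<Rightarrow> (nat \<Rightarrow> 'a set) \<Rightarrow> rpred \<Rightarrow> 'a set" where
  "frame_val F v (PVar i) = v i"
| "frame_val F v \<^bold>1' = fr_ids F"
| "frame_val F v (A \<^bold>+ B) = frame_val F v A \<union> frame_val F v B"
| "frame_val F v (\<^bold>- A) = fr_pts F - frame_val F v A"
| "frame_val F v (A \<^bold>; B) = {z. \<exists>x\<in>frame_val F v A. \<exists>y\<in>frame_val F v B. fr_rel F x y z}"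
| "frame_val F v (A\<^sup>\<smile>) = fr_star F ` frame_val F v A"

lemma frame_val_hom:
  assumes "is_frame F" "\<And>i. v i \<subseteq> fr_pts F"
  shows "frame_val F v \<in> ra_hom pred_alg (complex_algebra F)"
proof -
  have "frame_val F v A \<subseteq> fr_pts F" for A
    using assms by (induction A) (auto simp: is_frame_def)
  then show ?thesis by (auto simp: ra_hom_def pred_alg_def complex_algebra_def)
qed

context group
begin

lemma is_frame_group_frame: "is_frame (group_frame G)"
  by (auto simp: is_frame_def group_frame_def)

text \<open>In the model the equation \<open>1' \<le> P\<close> says that the relation of
  \<open>P\<close> contains the identity, in particular the pair of \<one> with itself, whose Cayley
  label is \<one>.\<close>

lemma not_CT_omega:
  assumes "h \<in> ra_hom pred_alg (complex_algebra (group_frame G))" "\<one> \<notin> h P"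
  shows "P \<notin> CT_omega"
proof
  interpret rel_interpretation "carrier G" "\<lambda>A. cayley (h A)"
    by (rule group_hom_interpretation[OF assms(1)])
  assume "P \<in> CT_omega"
  then have "valid (\<^bold>1' \<^bold>\<le> P)" unfolding CT_omega_def using soundness by blast
  then have "cayley (h (\<^bold>1' \<^bold>+ P)) = cayley (h P)"
    unfolding valid_def by (auto dest: spec[of _ "\<lambda>_. \<one>"])
  then have "Id_on (carrier G) \<subseteq> cayley (h P)" using h_add h_one by blast
  then have "(\<one>, \<one>) \<in> cayley (h P)" by (rule subsetD) blast
  then show False using assms(2) by (simp add: cayley_def)
qed

text \<open>Commutativity of the complex algebra makes the additional axioms true in the model; the
  sequent is then evaluated with every variable at \<one>.\<close>

lemma not_omega_provable:
  assumes "h \<in> ra_hom pred_alg (complex_algebra (group_frame G))" "\<one> \<notin> h P"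
    and "commutative_algebra (complex_algebra (group_frame G))"
  shows "\<not> omega_provable_from commutativity_eqs P"
proof
  interpret rel_interpretation "carrier G" "\<lambda>A. cayley (h A)"
    by (rule group_hom_interpretation[OF assms(1)])
  have "h (A \<^bold>; B) = h (B \<^bold>; A)" for A B
    using assms(1,3) by (simp add: ra_hom_def pred_alg_def commutative_algebra_def)
  then have comm: "cayley (h X) = cayley (h Y)" if "(X \<^bold>\<doteq> Y) \<in> commutativity_eqs" for X Y
    using that by (auto simp: commutativity_eqs_def)
  assume "omega_provable_from commutativity_eqs P"
  then have "seq_sat {} {(0, P, 0)} (\<lambda>_. \<one>)"
    unfolding omega_provable_from_def 
    using seq_soundness[of "{}" "{(0, P, 0)}" commutativity_eqs "\<lambda>_. \<one>", OF _ comm] by force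
  then have "(\<one>, \<one>) \<in> cayley (h P)" by (simp add: seq_sat_def)
  then show False using assms(2) by (simp add: cayley_def)
qed

lemma commutative_complex_algebra:
  assumes "\<And>x y. x \<in> carrier G \<Longrightarrow> y \<in> carrier G \<Longrightarrow> x \<otimes> y = y \<otimes> x"
  shows "commutative_algebra (complex_algebra (group_frame G))"
proof -
  have "fr_rel (group_frame G) x y z \<longleftrightarrow> fr_rel (group_frame G) y x z" for x y z
    using assms by (auto simp: group_frame_def)
  then have "{z. \<exists>x\<in>X. \<exists>y\<in>Y. fr_rel (group_frame G) x y z} =
      {z. \<exists>y\<in>Y. \<exists>x\<in>X. fr_rel (group_frame G) y x z}" for X Y
    by blast
  then show ?thesis by (simp add: commutative_algebra_def complex_algebra_def)
qed

end

section \<open>The group of order 2\<close>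

locale group_order_2 = group G for G (structure) +
  fixes g
  assumes carrier_eq: "carrier G = {\<one>, g}" and g_neq_one: "g \<noteq> \<one>"
begin

lemma g_closed: "g \<in> carrier G" by (simp add: carrier_eq)

lemma g_mult_g: "g \<otimes> g = \<one>"
proof -
  have "g \<otimes> g \<noteq> g"
    using g_neq_one l_cancel_one'[OF g_closed g_closed] by auto
  then show ?thesis using m_closed[OF g_closed g_closed] by (auto simp: carrier_eq)
qed

lemma inv_eq: "x \<in> carrier G \<Longrightarrow> inv x = x"
  using inv_equality[OF g_mult_g g_closed g_closed] by (auto simp: carrier_eq)

lemma commutative: "commutative_algebra (complex_algebra (group_frame G))"
  using g_closed by (intro commutative_complex_algebra) (auto simp: carrier_eq)

lemma group_mult:
  "\<one> \<otimes> \<one> = \<one>" "\<one> \<otimes> g = g" "g \<otimes> \<one> = g"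
  using g_closed by simp_all

lemma frame_rel:
  "fr_rel (group_frame G) x y z \<longleftrightarrow> x = \<one> \<and> y = \<one> \<and> z = \<one> \<or> x = \<one> \<and> y = g \<and> z = g \<or>
    x = g \<and> y = \<one> \<and> z = g \<or> x = g \<and> y = g \<and> z = \<one>"
  by (auto simp: group_frame_def carrier_eq g_mult_g group_mult g_neq_one)

lemma frame_pts: "fr_pts (group_frame G) = {\<one>, g}"
  by (simp add: group_frame_def carrier_eq)

lemma frame_ids: "fr_ids (group_frame G) = {\<one>}"
  by (simp add: group_frame_def)

lemma frame_star:
  assumes "S \<subseteq> {\<one>, g}"
  shows "fr_star (group_frame G) ` S = S"
proof -
  have "inv x = x" if "x \<in> S" for x using that assms inv_eq carrier_eq by blast
  then show ?thesis by (simp add: group_frame_def)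
qed

text \<open>Converse is trivial here, so \<open>X \<rightarrow> Y\<close> contains \<one> iff the
  value of \<open>X\<close> is included in that of \<open>Y\<close>; and with value {g} for
  \<open>A\<close>, the value of \<open>A \<rightarrow> X\<close> is that of \<open>X\<close>
  translated by \<open>g\<close>.\<close>

lemma refutes:
  fixes a b c :: nat
  defines "A \<equiv> PVar a" and "B \<equiv> PVar b" and "C \<equiv> PVar c"
  assumes "a \<noteq> b" "a \<noteq> c" "b \<noteq> c"
    and P: "P \<in> {(A \<^bold>\<rightarrow> \<^bold>\<sim> A) \<^bold>\<rightarrow> \<^bold>\<sim> A,
                 A \<^bold>\<and> B \<^bold>\<rightarrow> A \<^bold>\<circ> B,
                 (A \<^bold>\<rightarrow> B) \<^bold>\<rightarrow> \<^bold>\<sim> A \<^bold>\<or> B,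
                 (A \<^bold>\<rightarrow> (A \<^bold>\<rightarrow> B)) \<^bold>\<rightarrow> (A \<^bold>\<rightarrow> B),
                 (A \<^bold>\<rightarrow> (B \<^bold>\<rightarrow> C)) \<^bold>\<rightarrow> (A \<^bold>\<and> B \<^bold>\<rightarrow> C),
                 (A \<^bold>\<rightarrow> (B \<^bold>\<rightarrow> C)) \<^bold>\<rightarrow> ((A \<^bold>\<rightarrow> B) \<^bold>\<rightarrow> (A \<^bold>\<rightarrow> C))}"
  obtains h where "h \<in> ra_hom pred_alg (complex_algebra (group_frame G))" "\<one> \<notin> h P"
proof -
  \<comment> \<open>\<open>S\<close> is the value of \<open>B\<close>. Predicates (2) and (5) need
    \<open>S = {g}\<close>, since otherwise the meet of \<open>A\<close> and \<open>B\<close> is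
    empty; (3) needs \<open>S = {\<one>}\<close>, since otherwise its consequent is everything. The
    other three fail for both choices.\<close>
  define v where "v S = (\<lambda>i. if i = a then {g} else if i = b then S else {\<one>})" for S
  define h where "h S = frame_val (group_frame G) (v S)" for S
  have hom: "h S \<in> ra_hom pred_alg (complex_algebra (group_frame G))" if "S \<subseteq> carrier G" for S
    unfolding h_def using that g_closed
    by (intro frame_val_hom is_frame_group_frame) (auto simp: v_def group_frame_def)
  have vals: "h S A = {g}" "h S B = S" "h S C = {\<one>}" for S
    using assms(4-6) by (simp_all add: h_def v_def A_def B_def C_def)
  \<comment> \<open>The four-entry product table makes the evaluation of all six predicates a
    propositional computation about \<one> and \<open>g\<close>.\<close>
  have ops: "x \<in> h S (X \<^bold>+ Y) \<longleftrightarrow> x \<in> h S X \<or> x \<in> h S Y"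
    "x \<in> h S (\<^bold>- X) \<longleftrightarrow> x \<in> {\<one>, g} \<and> x \<notin> h S X"
    "\<one> \<in> h S (X \<^bold>; Y) \<longleftrightarrow> \<one> \<in> h S X \<and> \<one> \<in> h S Y \<or> g \<in> h S X \<and> g \<in> h S Y"
    "g \<in> h S (X \<^bold>; Y) \<longleftrightarrow> \<one> \<in> h S X \<and> g \<in> h S Y \<or> g \<in> h S X \<and> \<one> \<in> h S Y"
    for x S X Y
    using g_neq_one by (auto simp: h_def frame_pts frame_rel)
  have "h S (X\<^sup>\<smile>) = h S X" if "S \<subseteq> carrier G" for S X
    using hom[OF that] frame_star[of "h S X"]
    by (simp add: ra_hom_def pred_alg_def complex_algebra_def frame_pts)
  then have conv: "h {g} (X\<^sup>\<smile>) = h {g} X" "h {\<one>} (X\<^sup>\<smile>) = h {\<one>} X" for X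
    by (simp_all add: carrier_eq)
  have "{g} \<subseteq> carrier G" "{\<one>} \<subseteq> carrier G" by (auto simp: carrier_eq)
  moreover have "\<one> \<notin> h {g} P \<or> \<one> \<notin> h {\<one>} P"
    using P g_neq_one by (elim insertE emptyE)
      (simp_all add: ops vals conv)
  ultimately show ?thesis using hom that by blast
qed

end

section \<open>Validity in CR frames\<close>

text \<open>One direction of the postulates on exchange and on \<open>star\<close> is enough:
  exchanging \<open>b\<close> and \<open>c\<close>, respectively starring twice, gives back the
  other. The bounds on points are supplied by \<open>R_closed\<close>.\<close>

locale CR_frame =
  fixes K :: "'k set" and R :: "'k \<Rightarrow> 'k \<Rightarrow> 'k \<Rightarrow> bool" and star :: "'k \<Rightarrow> 'k" and z :: 'k
  assumes R_closed: "R a b c \<Longrightarrow> a \<in> K \<and> b \<in> K \<and> c \<in> K"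
    and star_closed: "a \<in> K \<Longrightarrow> star a \<in> K"
    and z_closed: "z \<in> K"
    and R_zero: "a \<in> K \<Longrightarrow> b \<in> K \<Longrightarrow> R z a b \<longleftrightarrow> a = b"
    and R_pasch: "\<lbrakk>R a b x; R x c d\<rbrakk> \<Longrightarrow> \<exists>y. R a c y \<and> R y b d"
    and R_idem: "a \<in> K \<Longrightarrow> R a a a"
    and star_star: "a \<in> K \<Longrightarrow> star (star a) = a"
    and R_star: "R a b c \<Longrightarrow> R a (star c) (star b)"
begin

text \<open>The exchange postulate with the zero point in first place: the intermediate point
  \<open>y\<close> it provides must equal \<open>b\<close>.\<close>

lemma R_commute:
  assumes "R a b c"
  shows "R b a c"
proof -
  have "a \<in> K" "b \<in> K" "c \<in> K" using R_closed[OF assms] by auto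
  then obtain y where "R z b y" "R y a c"
    using R_pasch[of z a a b c] R_zero[of a a] assms by blast
  then show ?thesis using R_zero[of b y] R_closed by blast
qed

text \<open>Starring the idempotence triple at \<open>star z\<close> gives
  \<open>R (star z) z z\<close>; after commuting, the zero point is in first place and forces
  equality.\<close>

lemma star_zero: "star z = z"
proof -
  have "R (star z) z z"
    using R_star[OF R_idem[OF star_closed[OF z_closed]]] star_star[OF z_closed] by simp
  then show ?thesis using R_commute R_zero star_closed z_closed by blast
qed

text \<open>Starring moves the zero point out of the last place and commuting brings it to the
  first. The lemma is what turns an inclusion into an implication true at \<open>z\<close>.\<close>

lemma R_star_zero:
  assumes "a \<in> K" "R (star a) b z"
  shows "a = b"
proof -
  have b: "b \<in> K" using R_closed[OF assms(2)] by blast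
  have "R z (star a) (star b)" using R_commute[OF R_star[OF assms(2)]] star_zero by simp
  then have "star a = star b" using R_zero star_closed assms(1) b by blast
  then show ?thesis using star_star assms(1) b by metis
qed

text \<open>Exchange applied to \<open>R a a a\<close> and \<open>R a b c\<close>: the frame
  counterpart of density, which lets \<open>a\<close> act twice.\<close>

lemma R_expand:
  assumes "R a b c"
  obtains y where "R a b y" "R a y c"
proof -
  have "a \<in> K" using R_closed[OF assms] by blast
  then obtain y where "R a b y" "R y a c" using R_pasch[OF R_idem assms] by blast
  then show ?thesis using that R_commute by blast
qed

end

locale CR_frame_hom = CR_frame +
  fixes h :: "rpred \<Rightarrow> 'a set"
  assumes h_subset: "h X \<subseteq> K"
    and h_add [simp]: "h (X \<^bold>+ Y) = h X \<union> h Y"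
    and h_compl [simp]: "h (\<^bold>- X) = K - h X"
    and h_comp: "h (X \<^bold>; Y) = {c. \<exists>a\<in>h X. \<exists>b\<in>h Y. R a b c}"
    and h_conv [simp]: "h (X\<^sup>\<smile>) = star ` h X"
begin

lemma h_K: "a \<in> h X \<Longrightarrow> a \<in> K" using h_subset by blast

text \<open>The complement of a relative product, unfolded: \<open>c\<close> is excluded exactly
  when some \<open>star a\<close> with \<open>a\<close> in the value of \<open>X\<close> and some
  \<open>b\<close> outside that of \<open>Y\<close> compose to \<open>c\<close>.\<close>

lemma mem_imp:
  "c \<in> h (X \<^bold>\<rightarrow> Y) \<longleftrightarrow> c \<in> K \<and> (\<forall>a\<in>h X. \<forall>b. R (star a) b c \<longrightarrow> b \<in> h Y)"
  by (auto simp: h_comp dest: R_closed)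

lemma zero_mem_imp:
  assumes "h X \<subseteq> h Y"
  shows "z \<in> h (X \<^bold>\<rightarrow> Y)"
  unfolding mem_imp using assms z_closed R_star_zero h_K by blast

text \<open>If \<open>c\<close> were \<open>star a\<close> with \<open>a\<close> in the value of
  \<open>A\<close>, the idempotence triple at \<open>c\<close> would be an instance of the clause
  for implication and exclude \<open>c\<close> from the starred value of \<open>A\<close>.\<close>

lemma reductio: "z \<in> h ((A \<^bold>\<rightarrow> \<^bold>\<sim> A) \<^bold>\<rightarrow> \<^bold>\<sim> A)"
proof (rule zero_mem_imp, rule subsetI)
  fix c assume c: "c \<in> h (A \<^bold>\<rightarrow> \<^bold>\<sim> A)"
  then have "c \<in> K" by (simp add: mem_imp)
  moreover have False if "c = star a" "a \<in> h A" for a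
  proof -
    have "star a \<in> K" using that \<open>c \<in> K\<close> by simp
    then have "R (star a) c c" using R_idem that by simp
    then have "c \<in> h (\<^bold>\<sim> A)" using c that(2) unfolding mem_imp by blast
    then show False using that by auto
  qed
  ultimately show "c \<in> h (\<^bold>\<sim> A)" by auto
qed

lemma meet_le_fusion: "z \<in> h (A \<^bold>\<and> B \<^bold>\<rightarrow> A \<^bold>\<circ> B)"
  by (rule zero_mem_imp) (auto simp: h_comp intro: R_idem)

lemma imp_le_or: "z \<in> h ((A \<^bold>\<rightarrow> B) \<^bold>\<rightarrow> \<^bold>\<sim> A \<^bold>\<or> B)"
proof (rule zero_mem_imp, rule subsetI)
  fix c assume c: "c \<in> h (A \<^bold>\<rightarrow> B)"
  then have "c \<in> K" by (simp add: mem_imp)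
  moreover have "c \<in> h B" if "c = star a" "a \<in> h A" for a
    using c that R_idem[OF \<open>c \<in> K\<close>] unfolding mem_imp by blast
  ultimately show "c \<in> h (\<^bold>\<sim> A \<^bold>\<or> B)" by auto
qed

lemma meet_importation: "z \<in> h ((A \<^bold>\<rightarrow> (B \<^bold>\<rightarrow> C)) \<^bold>\<rightarrow> (A \<^bold>\<and> B \<^bold>\<rightarrow> C))"
proof (rule zero_mem_imp, rule subsetI)
  fix c assume c: "c \<in> h (A \<^bold>\<rightarrow> (B \<^bold>\<rightarrow> C))"
  have "b \<in> h C" if ab: "a \<in> h (A \<^bold>\<and> B)" "R (star a) b c" for a b
  proof -
    \<comment> \<open>The point \<open>star a\<close> acts twice: through \<open>A\<close> it leads
      from \<open>c\<close> to \<open>y\<close>, through \<open>B\<close> from \<open>y\<close> to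
      \<open>b\<close>.\<close>
    obtain y where y: "R (star a) b y" "R (star a) y c" using R_expand[OF ab(2)] .
    have a: "a \<in> h A" "a \<in> h B" using ab(1) by auto
    have "y \<in> h (B \<^bold>\<rightarrow> C)" using c a(1) y(2) unfolding mem_imp[of _ A] by blast
    then show ?thesis using a(2) y(1) unfolding mem_imp by blast
  qed
  then show "c \<in> h (A \<^bold>\<and> B \<^bold>\<rightarrow> C)" using h_K[OF c] unfolding mem_imp[of _ "A \<^bold>\<and> B"] by blast
qed

lemma contraction: "z \<in> h ((A \<^bold>\<rightarrow> (A \<^bold>\<rightarrow> B)) \<^bold>\<rightarrow> (A \<^bold>\<rightarrow> B))"
proof (rule zero_mem_imp, rule subsetI)
  fix c assume c: "c \<in> h (A \<^bold>\<rightarrow> (A \<^bold>\<rightarrow> B))"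
  have "b \<in> h B" if ab: "a \<in> h A" "R (star a) b c" for a b
  proof -
    obtain y where y: "R (star a) b y" "R (star a) y c" using R_expand[OF ab(2)] .
    have "y \<in> h (A \<^bold>\<rightarrow> B)" using c ab(1) y(2) unfolding mem_imp[of _ A "A \<^bold>\<rightarrow> B"] by blast
    then show ?thesis using ab(1) y(1) unfolding mem_imp by blast
  qed
  then show "c \<in> h (A \<^bold>\<rightarrow> B)" using h_K[OF c] unfolding mem_imp[of _ A] by blast
qed

lemma self_distribution:
  "z \<in> h ((A \<^bold>\<rightarrow> (B \<^bold>\<rightarrow> C)) \<^bold>\<rightarrow> ((A \<^bold>\<rightarrow> B) \<^bold>\<rightarrow> (A \<^bold>\<rightarrow> C)))"
proof (rule zero_mem_imp, rule subsetI)
  fix c assume c: "c \<in> h (A \<^bold>\<rightarrow> (B \<^bold>\<rightarrow> C))"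
  have "x \<in> h C" if d: "d \<in> h (A \<^bold>\<rightarrow> B)" and a: "a \<in> h A"
    and R: "R (star d) y c" "R (star a) x y" for d y a x
  proof -
    \<comment> \<open>\<open>star a\<close> is duplicated; one copy is meant for
      \<open>A \<rightarrow> B\<close>, the other for the premise on \<open>c\<close>.\<close>
    obtain v where v: "R (star a) x v" "R (star a) v y" using R_expand[OF R(2)] .
    obtain w where w: "R (star a) (star d) w" "R w v c"
      using R_pasch[OF v(2) R_commute[OF R(1)]] by blast
    \<comment> \<open>Starring turns the product of \<open>star a\<close> and \<open>star d\<close>
      into a statement about \<open>d\<close> itself, so the clause for
      \<open>A \<rightarrow> B\<close> applies with argument \<open>a\<close> and result
      \<open>star w\<close>.\<close>
    have "R (star a) (star w) d" using R_star[OF w(1)] star_star[OF h_K[OF d]] by simp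
    then have "star w \<in> h B" using d a unfolding mem_imp by blast
    have "w = star (star w)" using star_star R_closed[OF w(2)] by simp
    \<comment> \<open>A second exchange moves the remaining copy of \<open>star a\<close> outermost,
      where the premise expects it; \<open>w\<close>, the star of a point in the value of
      \<open>B\<close>, is left to act on \<open>x\<close>.\<close>
    obtain u where u: "R x w u" "R u (star a) c"
      using R_pasch[OF R_commute[OF v(1)] R_commute[OF w(2)]] by blast
    have "u \<in> h (B \<^bold>\<rightarrow> C)" using c a R_commute[OF u(2)] unfolding mem_imp[of _ A] by blast
    moreover have "R (star (star w)) x u" using R_commute[OF u(1)] \<open>w = star (star w)\<close> by simp
    ultimately show ?thesis using \<open>star w \<in> h B\<close> unfolding mem_imp by blast
  qed
  then have "y \<in> h (A \<^bold>\<rightarrow> C)" if "d \<in> h (A \<^bold>\<rightarrow> B)" "R (star d) y c" for d y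
    using that R_closed unfolding mem_imp[of _ A C] by blast
  then show "c \<in> h ((A \<^bold>\<rightarrow> B) \<^bold>\<rightarrow> (A \<^bold>\<rightarrow> C))"
    using h_K[OF c] unfolding mem_imp[of _ "A \<^bold>\<rightarrow> B"] by blast
qed

end

lemma CR_starI:
  assumes "\<And>K R star z h. CR_frame_hom K R star z (h :: rpred \<Rightarrow> 'k set) \<Longrightarrow> z \<in> h P"
  shows "P \<in> CR_star TYPE('k)"
  unfolding CR_star_def valid_in_def
proof (intro CollectI allI impI ballI)
  fix F :: "'k frame" and h
  assume F: "is_CR_frame F" and h: "h \<in> ra_hom pred_alg (complex_algebra F)"
  let ?K = "fr_pts F" and ?R = "fr_rel F" and ?s = "fr_star F"
  obtain z where frame: "is_frame F" and z: "fr_ids F = {z}"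
    and ax: "\<forall>a\<in>?K. \<forall>b\<in>?K. \<forall>c\<in>?K. \<forall>d\<in>?K.
        (?R z a b \<longleftrightarrow> a = b) \<and>
        ((\<exists>x\<in>?K. ?R a b x \<and> ?R x c d) \<longleftrightarrow> (\<exists>y\<in>?K. ?R a c y \<and> ?R y b d)) \<and>
        ?R a a a \<and> ?s (?s a) = a \<and> (?R a b c \<longleftrightarrow> ?R a (?s c) (?s b))"
    using F unfolding is_CR_frame_def by (elim conjE exE) (rule that)
  note ax = ax[rule_format]
  have cl: "a \<in> ?K \<and> b \<in> ?K \<and> c \<in> ?K" if "?R a b c" for a b c
    using frame that by (simp add: is_frame_def)
  have "CR_frame_hom ?K ?R ?s z h"
  proof
    show "a \<in> ?K \<and> b \<in> ?K \<and> c \<in> ?K" if "?R a b c" for a b c using cl[OF that] .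
    show "?s a \<in> ?K" if "a \<in> ?K" for a using frame that by (simp add: is_frame_def)
    show "z \<in> ?K" using frame z by (simp add: is_frame_def)
    show "?R z a b \<longleftrightarrow> a = b" if "a \<in> ?K" "b \<in> ?K" for a b
      using ax[OF that that(1,1)] by blast
    show "\<exists>y. ?R a c y \<and> ?R y b d" if "?R a b x" "?R x c d" for a b c d x
      using conjunct1[OF conjunct2[OF ax[of a b c d]]] cl[OF that(1)] cl[OF that(2)] that by blast
    show "?R a a a" if "a \<in> ?K" for a using ax[OF that that that that] by blast
    show "?s (?s a) = a" if "a \<in> ?K" for a using ax[OF that that that that] by blast
    show "?R a (?s c) (?s b)" if "?R a b c" for a b c
      using ax[of a b c c] cl[OF that] that by blast
  qed (use h in \<open>auto simp: ra_hom_def pred_alg_def complex_algebra_def\<close>)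
  from assms[OF this] show "fr_ids F \<subseteq> h P" using z by simp
qed

lemma R_logicI:
  assumes "A \<in> prop_vars" "B \<in> prop_vars" "C \<in> prop_vars"
    and P: "P \<in> {(A \<^bold>\<rightarrow> \<^bold>\<sim> A) \<^bold>\<rightarrow> \<^bold>\<sim> A,
                 A \<^bold>\<and> B \<^bold>\<rightarrow> A \<^bold>\<circ> B,
                 (A \<^bold>\<rightarrow> B) \<^bold>\<rightarrow> \<^bold>\<sim> A \<^bold>\<or> B,
                 (A \<^bold>\<rightarrow> (A \<^bold>\<rightarrow> B)) \<^bold>\<rightarrow> (A \<^bold>\<rightarrow> B),
                 (A \<^bold>\<rightarrow> (B \<^bold>\<rightarrow> C)) \<^bold>\<rightarrow> (A \<^bold>\<and> B \<^bold>\<rightarrow> C),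
                 (A \<^bold>\<rightarrow> (B \<^bold>\<rightarrow> C)) \<^bold>\<rightarrow> ((A \<^bold>\<rightarrow> B) \<^bold>\<rightarrow> (A \<^bold>\<rightarrow> C))}"
  shows "P \<in> R_logic TYPE('k)"
proof -
  have v: "A \<in> relevant_preds" "B \<in> relevant_preds" "C \<in> relevant_preds"
    using assms by (auto intro: relevant_preds.intros(1) simp: basic_preds_def)
  have "P \<in> relevant_preds"
    using P by (elim insertE emptyE; simp only:; intro relevant_preds.intros(2-6) v)
  moreover have "P \<in> CR_star TYPE('k)"
  proof (rule CR_starI)
    fix K :: "'k set" and R star z h assume "CR_frame_hom K R star z h"
    then interpret CR_frame_hom K R star z h .
    show "z \<in> h P"
      using P by (elim insertE emptyE; simp only:; intro reductio meet_le_fusion imp_le_or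
        contraction meet_importation self_distribution)
  qed
  ultimately show ?thesis by (simp add: R_logic_def)
qed

theorem theorem25:
  fixes A B C :: rpred
    and G :: "('g, 'm) monoid_scheme"
  assumes "A \<in> prop_vars" "B \<in> prop_vars" "C \<in> prop_vars"
    and "A \<noteq> B" "A \<noteq> C" "B \<noteq> C"
    and "group G" "order G = 2"
  shows "(\<forall>P \<in> {(A \<^bold>\<rightarrow> \<^bold>\<sim> A) \<^bold>\<rightarrow> \<^bold>\<sim> A,
                 A \<^bold>\<and> B \<^bold>\<rightarrow> A \<^bold>\<circ> B,
                 (A \<^bold>\<rightarrow> B) \<^bold>\<rightarrow> \<^bold>\<sim> A \<^bold>\<or> B,
                 (A \<^bold>\<rightarrow> (A \<^bold>\<rightarrow> B)) \<^bold>\<rightarrow> (A \<^bold>\<rightarrow> B),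
                 (A \<^bold>\<rightarrow> (B \<^bold>\<rightarrow> C)) \<^bold>\<rightarrow> (A \<^bold>\<and> B \<^bold>\<rightarrow> C),
                 (A \<^bold>\<rightarrow> (B \<^bold>\<rightarrow> C)) \<^bold>\<rightarrow> ((A \<^bold>\<rightarrow> B) \<^bold>\<rightarrow> (A \<^bold>\<rightarrow> C))}.
            P \<in> R_logic TYPE('k) \<and>
            P \<in> TR \<and>
            P \<notin> CT_omega \<and>
            \<not> omega_provable_from commutativity_eqs P \<and>
            \<not> valid_in (group_frame G) P)
         \<and> representable_relation_algebra (complex_algebra (group_frame G))
         \<and> commutative_algebra (complex_algebra (group_frame G))"
proof -
  obtain g where "carrier G = {\<one>\<^bsub>G\<^esub>, g}" "g \<noteq> \<one>\<^bsub>G\<^esub>"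
  proof -
    have "card (carrier G) = 2" using assms(8) by (simp add: order_def)
    then obtain x y where "carrier G = {x, y}" "x \<noteq> y" by (auto simp: card_2_iff)
    \<comment> \<open>The cardinality does not tell which of the two elements is the unit, hence a
      case distinction.\<close>
    then show ?thesis
      using that monoid.one_closed[OF group.is_monoid[OF assms(7)]] by fastforce
  qed
  then interpret group_order_2 G g
    using assms(7) by (simp add: group_order_2_def group_order_2_axioms_def)
  interpret tr: dense_commutative_calculus 4 "density_eqs \<union> commutativity_eqs"
    by unfold_locales (simp_all add: numeral_eq_enat)
  obtain a b c where abc: "A = PVar a" "B = PVar b" "C = PVar c"
    using assms(1-3) by (auto simp: prop_vars_def)
  then have dist: "a \<noteq> b" "a \<noteq> c" "b \<noteq> c" using assms(4-6) by auto
  show ?thesis (is "(\<forall>P\<in>?S. _ P) \<and> _")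
  proof (intro conjI ballI)
    fix P assume P: "P \<in> ?S"
    show "P \<in> R_logic TYPE('k)" by (rule R_logicI[OF assms(1-3) P])
    show "P \<in> TR"
      unfolding TR_def mem_Collect_eq
      using P by (elim insertE emptyE; simp only:; intro tr.reductio tr.meet_le_fusion
        tr.imp_le_or tr.contraction tr.meet_importation tr.self_distribution)
    obtain h where h: "h \<in> ra_hom pred_alg (complex_algebra (group_frame G))" "\<one>\<^bsub>G\<^esub> \<notin> h P"
      using P unfolding abc by (rule refutes[OF dist])
    show "P \<notin> CT_omega" by (rule not_CT_omega[OF h])
    show "\<not> omega_provable_from commutativity_eqs P"
      by (rule not_omega_provable[OF h commutative])
    show "\<not> valid_in (group_frame G) P"
      unfolding valid_in_def frame_ids using h by blast
  qed (rule representable_complex_algebra commutative)+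
qed

end
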